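(* Let $G$ be a finite abelian $p$-group. (I) Let $\triangleleft,\triangleleft'$ be actions of $C_p$ on $G$ by automorphisms, and $\tau\in Z^2_c(\triangleleft)$, $\tau'\in Z^2_c(\triangleleft')$. Noncocommutative extensions $H(\tau,\triangleleft)$ and $H(\tau',\triangleleft')$ are isomorphic as Hopf algebras if and only if (i) there exist $\alpha\in A_p$ and a $C_p$-isomorphism $\lambda:(G,\triangleleft)\to(G,\triangleleft'^{\alpha})$ such that (ii) $\tau'=\tau.(\lambda\alpha^{-1})$ in $H^2_c(\triangleleft')$. (II) Let $\triangleleft$ be an action of $C_p$ on $G$ by automorphisms. There is a bijection between the orbits of $\mathcal{G}(\triangleleft)$ in $H^2_c(\triangleleft)$ not contained in $H^2_{\mathrm{cc}}(\triangleleft)$ and the isomorphism classes of noncocommutative extensions (as Hopf algebras) in $\mathrm{Ext}_{[\triangleleft]}(\Bbbk C_p,\Bbbk^G)$.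
   Context: $\Bbbk$ is an algebraically closed field of characteristic $0$, $p$ a prime, $C_p$ the cyclic group of order $p$, $\Bbbk^G$ the Hopf algebra of functions on $G$ (dual of $\Bbbk G$) with basis $\{p_a\}_{a\in G}$ of delta functions. Actions $\triangleleft$ of $C_p$ on $G$ are right actions by group automorphisms; automorphisms of $G$ are written on the right. Put $(x\bullet f)(a)=f(a\triangleleft x)$ for $f\in\Bbbk^G$. Cochains are normalized (value $1$ if some argument is the identity). Cohomology: $Z^2_c(\triangleleft)$ is the group of $\tau:C_p\times G\times G\to\Bbbk^\times$ with $\tau(x,a,bc)\tau(x,b,c)=\tau(x,ab,c)\tau(x,a,b)$ and $\tau(xy,a,b)=\tau(x,a,b)\tau(y,a\triangleleft x,b\triangleleft x)$. For $\eta:C_p\times G\to\Bbbk^\times$ let $(\delta_G\eta)(x,a,b)=\eta(x,a)\eta(x,b)\eta(x,ab)^{-1}$. $B^2_c(\triangleleft)=\{\delta_G\eta : \eta(xy,a)=\eta(x,a)\eta(y,a\triangleleft x)\}$, $B^2_{\mathrm{cc}}(\triangleleft)=\{\delta_G\eta\}\cap Z^2_c(\triangleleft)$ ($\eta$ an arbitrary normalized function), $H^2_c(\triangleleft)=Z^2_c(\triangleleft)/B^2_c(\triangleleft)$, $H^2_{\mathrm{cc}}(\triangleleft)=B^2_{\mathrm{cc}}(\triangleleft)/B^2_c(\triangleleft)$. The same symbol is used for a cocycle and its class. Extensions: an extension of $\Bbbk C_p$ by $\Bbbk^G$ is a sequence of Hopf maps $\Bbbk^G\xrightarrow{\iota}H\xrightarrow{\pi}\Bbbk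 C_p$ with $\iota$ injective, $\pi$ surjective, $\iota(\Bbbk^G)$ normal in $H$ and $\ker\pi=\iota(\Bbbk^G)^+H$; equivalences are Hopf isomorphisms compatible with $\iota$ and $\pi$. For $\tau\in Z^2_c(\triangleleft)$, $H(\tau,\triangleleft)$ is the extension with underlying space $\bigoplus_{x\in C_p}\Bbbk^G\bar x$, multiplication $(f\bar x)(f'\bar y)=f(x\bullet f')\overline{xy}$, comultiplication $\Delta(f\bar x)=\sum_{a,b\in G}\tau(x,a,b)f_1p_a\bar x\otimes f_2p_b\bar x$ and counit $\varepsilon(f\bar x)=f(1)$. Every extension of $\Bbbk C_p$ by $\Bbbk^G$ is equivalent to some $H(\tau,\triangleleft)$, and $H(\tau,\triangleleft)$, $H(\tau',\triangleleft')$ are equivalent iff $\triangleleft=\triangleleft'$ and $\tau=\tau'$ in $H^2_c(\triangleleft)$. Groups: $A_p=\mathrm{Aut}(C_p)$; for $\alpha\in A_p$, $a\triangleleft^\alpha x:=a\triangleleft\alpha(x)$. $I(\triangleleft,\triangleleft')$ is the set of $\lambda\in\mathrm{Aut}(G)$ with $(a\triangleleft x)\lambda=(a\lambda)\triangleleft' x$ (i.e. $C_p$-isomorphisms $(G,\triangleleft)\to(G,\triangleleft')$). $[\triangleleft]$ is the set of actions $\triangleleft'$ isomorphic to $\triangleleft^\alpha$ for some $\alpha\in A_p$, and $\mathrm{Ext}_{[\triangleleft]}(\Bbbk C_p,\Bbbk^G)$ is the set of equivalence classes of extensions $H(\tau,\triangleleft')$ with $\triangleleft'\in[\triangleleft]$.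 $\mathbb{A}(\triangleleft)=I(\triangleleft,\triangleleft)$. For $\lambda\in\mathrm{Aut}(G)$, $\alpha\in A_p$: $(\tau.\lambda)(x,a,b)=\tau(x,a\lambda^{-1},b\lambda^{-1})$, $(\tau.\alpha)(x,a,b)=\tau(\alpha(x),a,b)$, and $\tau.(\lambda\alpha^{-1})=(\tau.\lambda).\alpha^{-1}$; if $\lambda\in I(\triangleleft,\triangleleft'^{\alpha})$ then $\tau\mapsto\tau.(\lambda\alpha^{-1})$ induces an isomorphism $H^2_c(\triangleleft)\to H^2_c(\triangleleft')$. $C(\triangleleft)=\{\alpha\in A_p: I(\triangleleft,\triangleleft^\alpha)\neq\emptyset\}$, a subgroup of $A_p$. If $\triangleleft$ is nontrivial, fix $\lambda_\alpha\in I(\triangleleft,\triangleleft^\alpha)$ for each $\alpha\in C(\triangleleft)$; $\mathcal{G}(\triangleleft)$ is the subgroup of $\mathrm{Aut}(G)$ generated by $\mathbb{A}(\triangleleft)$ and all $\lambda_\alpha$ (its elements are uniquely $\phi\lambda_\alpha$ with $\phi\in\mathbb{A}(\triangleleft)$, $\alpha\in C(\triangleleft)$). It acts on $H^2_c(\triangleleft)$ by letting $\lambda=\phi\lambda_\alpha\in I(\triangleleft,\triangleleft^\alpha)$ act as $\tau\mapsto\tau.(\lambda\alpha^{-1})$. If $\triangleleft$ is trivial, $\mathcal{G}(\triangleleft)=\mathrm{Aut}(G)\times A_p$, with $(\lambda,\alpha)$ acting as $\tau\mapsto\tau.(\lambda\alpha^{-1})$. *)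

theory Defs
  imports "HOL-Analysis.Analysis" "HOL-Algebra.Generated_Groups" "HOL-Algebra.Group_Action"
begin

section \<open>Tensor products of coordinate spaces\<close>

text \<open>
  Vector spaces are coordinate spaces \<open>'k^'b\<close> over a finite index type, and the tensor product of
  \<open>'k^'b\<close> and \<open>'k^'c\<close> is \<open>'k^('b \<times> 'c)\<close> with the pure tensors below.
  \<open>tlift f\<close> is the linear map out of the tensor product that a bilinear \<open>f\<close> induces.
\<close>

definition tensor :: "'k::field ^ 'b::finite \<Rightarrow> 'k ^ 'c::finite \<Rightarrow> 'k ^ ('b \<times> 'c)" (infixr \<open>\<star>\<close> 75)
  where "v \<star> w = (\<chi> i. v $ fst i * w $ snd i)"

definition tlift ::
    "('k::field ^ 'b::finite \<Rightarrow> 'k ^ 'c::finite \<Rightarrow> 'k ^ 'd::finite) \<Rightarrow> 'k ^ ('b \<times> 'c) \<Rightarrow> 'k ^ 'd"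
  where "tlift f t = (\<Sum>b\<in>UNIV. \<Sum>c\<in>UNIV. t $ (b, c) *s f (axis b 1) (axis c 1))"

definition tensor_map ::
    "('k::field ^ 'b::finite \<Rightarrow> 'k ^ 'd::finite) \<Rightarrow> ('k ^ 'c::finite \<Rightarrow> 'k ^ 'e::finite)
      \<Rightarrow> 'k ^ ('b \<times> 'c) \<Rightarrow> 'k ^ ('d \<times> 'e)"
  where "tensor_map f g = tlift (\<lambda>v w. f v \<star> g w)"


section \<open>Hopf algebras and extensions\<close>

record ('k, 'b) hopf =
  hmult :: "'k ^ ('b::finite) \<Rightarrow> 'k ^ 'b \<Rightarrow> 'k ^ 'b"
  hone :: "'k ^ 'b"
  hcomult :: "'k ^ 'b \<Rightarrow> 'k ^ ('b \<times> 'b)"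
  hcounit :: "'k ^ 'b \<Rightarrow> 'k"

definition tensor_mult ::
    "('k::field, 'b::finite) hopf \<Rightarrow> 'k ^ ('b \<times> 'b) \<Rightarrow> 'k ^ ('b \<times> 'b) \<Rightarrow> 'k ^ ('b \<times> 'b)"
  where "tensor_mult H s t =
    tlift (\<lambda>v w. tlift (\<lambda>v' w'. hmult H v v' \<star> hmult H w w') t) s"

definition is_algebra :: "('k::field, 'b::finite) hopf \<Rightarrow> bool"
  where "is_algebra H \<longleftrightarrow>
    (\<forall>v. Vector_Spaces.linear (*s) (*s) (hmult H v)) \<and>
    (\<forall>w. Vector_Spaces.linear (*s) (*s) (\<lambda>v. hmult H v w)) \<and>
    (\<forall>u v w. hmult H (hmult H u v) w = hmult H u (hmult H v w)) \<and>
    (\<forall>v. hmult H (hone H) v = v \<and> hmult H v (hone H) = v)"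

definition is_coalgebra :: "('k::field, 'b::finite) hopf \<Rightarrow> bool"
  where "is_coalgebra H \<longleftrightarrow>
    Vector_Spaces.linear (*s) (*s) (hcomult H) \<and>
    Vector_Spaces.linear (*s) (*) (hcounit H) \<and>
    (\<forall>h a b c. tensor_map (hcomult H) id (hcomult H h) $ ((a, b), c) =
               tensor_map id (hcomult H) (hcomult H h) $ (a, (b, c))) \<and>
    (\<forall>h. tlift (\<lambda>v w. hcounit H v *s w) (hcomult H h) = h) \<and>
    (\<forall>h. tlift (\<lambda>v w. hcounit H w *s v) (hcomult H h) = h)"

definition is_bialgebra :: "('k::field, 'b::finite) hopf \<Rightarrow> bool"
  where "is_bialgebra H \<longleftrightarrow> is_algebra H \<and> is_coalgebra H \<and>
    hcomult H (hone H) = hone H \<star> hone H \<and>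
    (\<forall>v w. hcomult H (hmult H v w) = tensor_mult H (hcomult H v) (hcomult H w)) \<and>
    hcounit H (hone H) = 1 \<and>
    (\<forall>v w. hcounit H (hmult H v w) = hcounit H v * hcounit H w)"

definition is_antipode :: "('k::field, 'b::finite) hopf \<Rightarrow> ('k ^ 'b \<Rightarrow> 'k ^ 'b) \<Rightarrow> bool"
  where "is_antipode H S \<longleftrightarrow> Vector_Spaces.linear (*s) (*s) S \<and>
    (\<forall>h. tlift (\<lambda>v w. hmult H (S v) w) (hcomult H h) = hcounit H h *s hone H) \<and>
    (\<forall>h. tlift (\<lambda>v w. hmult H v (S w)) (hcomult H h) = hcounit H h *s hone H)"

definition is_hopf_algebra :: "('k::field, 'b::finite) hopf \<Rightarrow> bool"
  where "is_hopf_algebra H \<longleftrightarrow> is_bialgebra H \<and> (\<exists>S. is_antipode H S)"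

definition cocommutative :: "('k::field, 'b::finite) hopf \<Rightarrow> bool"
  where "cocommutative H \<longleftrightarrow> (\<forall>h b c. hcomult H h $ (b, c) = hcomult H h $ (c, b))"

text \<open>Bialgebra maps between Hopf algebras commute with the antipodes automatically.\<close>

definition hopf_hom ::
    "('k::field, 'b::finite) hopf \<Rightarrow> ('k, 'c::finite) hopf \<Rightarrow> ('k ^ 'b \<Rightarrow> 'k ^ 'c) \<Rightarrow> bool"
  where "hopf_hom H H' f \<longleftrightarrow> Vector_Spaces.linear (*s) (*s) f \<and>
    (\<forall>v w. f (hmult H v w) = hmult H' (f v) (f w)) \<and>
    f (hone H) = hone H' \<and>
    (\<forall>v. hcomult H' (f v) = tensor_map f f (hcomult H v)) \<and>
    (\<forall>v. hcounit H' (f v) = hcounit H v)"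

definition hopf_iso ::
    "('k::field, 'b::finite) hopf \<Rightarrow> ('k, 'c::finite) hopf \<Rightarrow> ('k ^ 'b \<Rightarrow> 'k ^ 'c) \<Rightarrow> bool"
  where "hopf_iso H H' f \<longleftrightarrow> hopf_hom H H' f \<and> bij f"

definition hopf_isomorphic :: "('k::field, 'b::finite) hopf \<Rightarrow> ('k, 'c::finite) hopf \<Rightarrow> bool"
  where "hopf_isomorphic H H' \<longleftrightarrow> (\<exists>f. hopf_iso H H' f)"

text \<open>Stability under both adjoint actions; the antipode is unique when it exists.\<close>

definition normal_in :: "('k::field ^ 'b::finite) set \<Rightarrow> ('k, 'b) hopf \<Rightarrow> bool"
  where "normal_in A H \<longleftrightarrow> (\<exists>S. is_antipode H S \<and> (\<forall>a\<in>A. \<forall>h.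
    tlift (\<lambda>v w. hmult H (hmult H v a) (S w)) (hcomult H h) \<in> A \<and>
    tlift (\<lambda>v w. hmult H (hmult H (S v) a) w) (hcomult H h) \<in> A))"

text \<open>
  The function algebra of \<open>'g\<close>, with \<open>p\<^sub>a = axis a 1\<close>, and the group algebra of \<open>'c\<close>, with
  group-likes \<open>axis x 1\<close>. Groups are written additively.
\<close>

definition fun_alg :: "('k::field, 'g::{finite, ab_group_add}) hopf"
  where "fun_alg = \<lparr>
    hmult = (*),
    hone = 1,
    hcomult = (\<lambda>f. \<chi> i. f $ (fst i + snd i)),
    hcounit = (\<lambda>f. f $ 0)\<rparr>"

definition grp_alg :: "('k::field, 'c::{finite, ab_group_add}) hopf"
  where "grp_alg = \<lparr>
    hmult = (\<lambda>u v. \<Sum>x\<in>UNIV. \<Sum>y\<in>UNIV. (u $ x * v $ y) *s axis (x + y) 1),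
    hone = axis 0 1,
    hcomult = (\<lambda>u. \<Sum>x\<in>UNIV. u $ x *s (axis x 1 \<star> axis x 1)),
    hcounit = (\<lambda>u. \<Sum>x\<in>UNIV. u $ x)\<rparr>"

type_synonym ('k, 'c, 'g, 'b) ext = "('k, 'b) hopf \<times> ('k ^ 'g \<Rightarrow> 'k ^ 'b) \<times> ('k ^ 'b \<Rightarrow> 'k ^ 'c)"

definition is_extension ::
    "('k::field, 'c::{finite, ab_group_add}, 'g::{finite, ab_group_add}, 'b::finite) ext \<Rightarrow> bool"
  where "is_extension E \<longleftrightarrow> (case E of (H, \<iota>, \<pi>) \<Rightarrow>
    is_hopf_algebra H \<and> hopf_hom fun_alg H \<iota> \<and> hopf_hom H grp_alg \<pi> \<and> inj \<iota> \<and> surj \<pi> \<and>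
    normal_in (range \<iota>) H \<and>
    {h. \<pi> h = 0} = vec.span {hmult H a h | a h. a \<in> range \<iota> \<and> hcounit H a = 0})"

definition ext_equiv ::
    "(('k::field, 'c::{finite, ab_group_add}, 'g::{finite, ab_group_add}, 'b::finite) ext
      \<times> ('k, 'c, 'g, 'b) ext) set"
  where "ext_equiv = {((H, \<iota>, \<pi>), (H', \<iota>', \<pi>')).
    is_extension (H, \<iota>, \<pi>) \<and> is_extension (H', \<iota>', \<pi>') \<and>
    (\<exists>f. hopf_iso H H' f \<and> f \<circ> \<iota> = \<iota>' \<and> \<pi>' \<circ> f = \<pi>)}"


section \<open>Automorphisms and actions\<close>

definition add_grp :: "'a::ab_group_add monoid"
  where "add_grp = \<lparr>carrier = UNIV, monoid.mult = (+), one = 0\<rparr>"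

text \<open>
  Automorphisms are functions, so the product \<open>\<lambda>\<mu>\<close> of automorphisms written on the right is
  \<open>\<mu> \<circ> \<lambda>\<close>, whereas \<open>AutoGroup\<close> multiplies by composition. Right actions of groups of
  automorphisms are thereby left actions of subgroups of \<open>AutoGroup\<close>, with the same orbits, and
  generated subgroups are the same sets.
\<close>

definition is_action :: "('g::ab_group_add \<Rightarrow> 'c::ab_group_add \<Rightarrow> 'g) \<Rightarrow> bool"
  where "is_action r \<longleftrightarrow>
    (\<forall>a. r a 0 = a) \<and> (\<forall>a x y. r a (x + y) = r (r a x) y) \<and>
    (\<forall>a b x. r (a + b) x = r a x + r b x)"

definition trivial_action :: "('g \<Rightarrow> 'c \<Rightarrow> 'g) \<Rightarrow> bool"
  where "trivial_action r \<longleftrightarrow> (\<forall>a x. r a x = a)"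

definition act_pow :: "('g \<Rightarrow> 'c \<Rightarrow> 'g) \<Rightarrow> ('c \<Rightarrow> 'c) \<Rightarrow> 'g \<Rightarrow> 'c \<Rightarrow> 'g"
  where "act_pow r \<alpha> = (\<lambda>a x. r a (\<alpha> x))"

definition act_isos :: "('g::ab_group_add \<Rightarrow> 'c \<Rightarrow> 'g) \<Rightarrow> ('g \<Rightarrow> 'c \<Rightarrow> 'g) \<Rightarrow> ('g \<Rightarrow> 'g) set"
  where "act_isos r r' = {l \<in> auto add_grp. \<forall>a x. l (r a x) = r' (l a) x}"

definition act_class ::
    "('g::ab_group_add \<Rightarrow> 'c::ab_group_add \<Rightarrow> 'g) \<Rightarrow> ('g \<Rightarrow> 'c \<Rightarrow> 'g) set"
  where "act_class r = {r'. is_action r' \<and> (\<exists>\<alpha>\<in>auto add_grp. act_isos r' (act_pow r \<alpha>) \<noteq> {})}"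

definition stab_C :: "('g::ab_group_add \<Rightarrow> 'c::ab_group_add \<Rightarrow> 'g) \<Rightarrow> ('c \<Rightarrow> 'c) set"
  where "stab_C r = {\<alpha> \<in> auto add_grp. act_isos r (act_pow r \<alpha>) \<noteq> {}}"


section \<open>Cohomology\<close>

definition Z2_c ::
    "('g::ab_group_add \<Rightarrow> 'c::ab_group_add \<Rightarrow> 'g) \<Rightarrow> ('c \<Rightarrow> 'g \<Rightarrow> 'g \<Rightarrow> 'k::field) monoid"
  where "Z2_c r = \<lparr>
    carrier = {\<tau>.
      (\<forall>x a b. \<tau> x a b \<noteq> 0) \<and>
      (\<forall>a b. \<tau> 0 a b = 1) \<and> (\<forall>x b. \<tau> x 0 b = 1) \<and> (\<forall>x a. \<tau> x a 0 = 1) \<and>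
      (\<forall>x a b c. \<tau> x a (b + c) * \<tau> x b c = \<tau> x (a + b) c * \<tau> x a b) \<and>
      (\<forall>x y a b. \<tau> (x + y) a b = \<tau> x a b * \<tau> y (r a x) (r b x))},
    monoid.mult = (\<lambda>\<sigma> \<tau> x a b. \<sigma> x a b * \<tau> x a b),
    one = (\<lambda>x a b. 1)\<rparr>"

definition cochains1 :: "('c::zero \<Rightarrow> 'g::zero \<Rightarrow> 'k::field) set"
  where "cochains1 = {\<eta>. (\<forall>x a. \<eta> x a \<noteq> 0) \<and> (\<forall>a. \<eta> 0 a = 1) \<and> (\<forall>x. \<eta> x 0 = 1)}"

definition dG :: "('c \<Rightarrow> 'g::plus \<Rightarrow> 'k::field) \<Rightarrow> 'c \<Rightarrow> 'g \<Rightarrow> 'g \<Rightarrow> 'k"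
  where "dG \<eta> = (\<lambda>x a b. \<eta> x a * \<eta> x b * inverse (\<eta> x (a + b)))"

definition B2_c ::
    "('g::ab_group_add \<Rightarrow> 'c::ab_group_add \<Rightarrow> 'g) \<Rightarrow> ('c \<Rightarrow> 'g \<Rightarrow> 'g \<Rightarrow> 'k::field) set"
  where "B2_c r = {dG \<eta> | \<eta>. \<eta> \<in> cochains1 \<and> (\<forall>x y a. \<eta> (x + y) a = \<eta> x a * \<eta> y (r a x))}"

definition B2_cc ::
    "('g::ab_group_add \<Rightarrow> 'c::ab_group_add \<Rightarrow> 'g) \<Rightarrow> ('c \<Rightarrow> 'g \<Rightarrow> 'g \<Rightarrow> 'k::field) set"
  where "B2_cc r = dG ` cochains1 \<inter> carrier (Z2_c r)"

definition H2_c ::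
    "('g::ab_group_add \<Rightarrow> 'c::ab_group_add \<Rightarrow> 'g) \<Rightarrow> ('c \<Rightarrow> 'g \<Rightarrow> 'g \<Rightarrow> 'k::field) set monoid"
  where "H2_c r = Z2_c r Mod B2_c r"

definition H2_cc ::
    "('g::ab_group_add \<Rightarrow> 'c::ab_group_add \<Rightarrow> 'g) \<Rightarrow> ('c \<Rightarrow> 'g \<Rightarrow> 'g \<Rightarrow> 'k::field) set monoid"
  where "H2_cc r = (Z2_c r)\<lparr>carrier := B2_cc r\<rparr> Mod B2_c r"

definition cls ::
    "('g::ab_group_add \<Rightarrow> 'c::ab_group_add \<Rightarrow> 'g) \<Rightarrow> ('c \<Rightarrow> 'g \<Rightarrow> 'g \<Rightarrow> 'k::field)
      \<Rightarrow> ('c \<Rightarrow> 'g \<Rightarrow> 'g \<Rightarrow> 'k) set"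
  where "cls r \<tau> = B2_c r #>\<^bsub>Z2_c r\<^esub> \<tau>"

definition coc_aut :: "('c \<Rightarrow> 'g \<Rightarrow> 'g \<Rightarrow> 'k) \<Rightarrow> ('g \<Rightarrow> 'g) \<Rightarrow> 'c \<Rightarrow> 'g \<Rightarrow> 'g \<Rightarrow> 'k"
  where "coc_aut \<tau> l = (\<lambda>x a b. \<tau> x (inv_into UNIV l a) (inv_into UNIV l b))"

definition coc_pow :: "('c \<Rightarrow> 'g \<Rightarrow> 'g \<Rightarrow> 'k) \<Rightarrow> ('c \<Rightarrow> 'c) \<Rightarrow> 'c \<Rightarrow> 'g \<Rightarrow> 'g \<Rightarrow> 'k"
  where "coc_pow \<tau> \<alpha> = (\<lambda>x a b. \<tau> (\<alpha> x) a b)"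

text \<open>\<open>twist l \<alpha> \<tau>\<close> is \<open>\<tau>.(l \<alpha>\<inverse>)\<close>.\<close>

definition twist ::
    "('g \<Rightarrow> 'g) \<Rightarrow> ('c \<Rightarrow> 'c) \<Rightarrow> ('c \<Rightarrow> 'g \<Rightarrow> 'g \<Rightarrow> 'k) \<Rightarrow> 'c \<Rightarrow> 'g \<Rightarrow> 'g \<Rightarrow> 'k"
  where "twist l \<alpha> \<tau> = coc_pow (coc_aut \<tau> l) (inv_into UNIV \<alpha>)"

text \<open>
  The group acting on \<open>H2_c r\<close> for nontrivial \<open>r\<close>, depending on the chosen
  \<open>lam \<alpha> \<in> act_isos r (act_pow r \<alpha>)\<close>. A nontrivial action of a group of prime order is
  faithful, so each element lies in \<open>act_isos r (act_pow r \<alpha>)\<close> for exactly one automorphism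
  \<open>\<alpha>\<close>, which is the one used to define the action.
\<close>

definition GG ::
    "('g::ab_group_add \<Rightarrow> 'c::ab_group_add \<Rightarrow> 'g) \<Rightarrow> (('c \<Rightarrow> 'c) \<Rightarrow> 'g \<Rightarrow> 'g) \<Rightarrow> ('g \<Rightarrow> 'g) monoid"
  where "GG r lam = (AutoGroup add_grp)
    \<lparr>carrier := generate (AutoGroup add_grp) (act_isos r r \<union> lam ` stab_C r)\<rparr>"

definition GG_act ::
    "('g::ab_group_add \<Rightarrow> 'c::ab_group_add \<Rightarrow> 'g) \<Rightarrow> ('g \<Rightarrow> 'g)
      \<Rightarrow> ('c \<Rightarrow> 'g \<Rightarrow> 'g \<Rightarrow> 'k) set \<Rightarrow> ('c \<Rightarrow> 'g \<Rightarrow> 'g \<Rightarrow> 'k) set"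
  where "GG_act r l T = twist l (THE \<alpha>. \<alpha> \<in> stab_C r \<and> l \<in> act_isos r (act_pow r \<alpha>)) ` T"

definition GG_orbits ::
    "('g::ab_group_add \<Rightarrow> 'c::ab_group_add \<Rightarrow> 'g) \<Rightarrow> (('c \<Rightarrow> 'c) \<Rightarrow> 'g \<Rightarrow> 'g)
      \<Rightarrow> ('c \<Rightarrow> 'g \<Rightarrow> 'g \<Rightarrow> 'k::field) set set set"
  where "GG_orbits r lam =
    (if trivial_action r
     then orbits (AutoGroup (add_grp :: 'g monoid) \<times>\<times> AutoGroup (add_grp :: 'c monoid))
            (carrier (H2_c r)) (\<lambda>(l, \<alpha>) T. twist l \<alpha> ` T)
     else orbits (GG r lam) (carrier (H2_c r)) (GG_act r))"


section \<open>The extensions attached to cocycles\<close>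

text \<open>
  An element \<open>F\<close> of \<open>'k^('c \<times> 'g)\<close> is the sum over \<open>x\<close> of \<open>bar (component F x) x\<close>, where \<open>bar f x\<close> is
  the element \<open>f\<close> placed in the summand with index \<open>x\<close>. The structure maps of the extension are
  \<open>f \<mapsto> bar f 0\<close> and \<open>bar f x \<mapsto> f(0) x\<close>.
\<close>

definition bar :: "'k::field ^ 'g::finite \<Rightarrow> 'c::finite \<Rightarrow> 'k ^ ('c \<times> 'g)"
  where "bar f x = (\<chi> i. if fst i = x then f $ snd i else 0)"

definition component :: "'k::field ^ ('c::finite \<times> 'g::finite) \<Rightarrow> 'c \<Rightarrow> 'k ^ 'g"
  where "component F x = (\<chi> a. F $ (x, a))"

definition bullet :: "('g \<Rightarrow> 'c \<Rightarrow> 'g) \<Rightarrow> 'c \<Rightarrow> 'k::field ^ 'g::finite \<Rightarrow> 'k ^ 'g"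
  where "bullet r x f = (\<chi> a. f $ r a x)"

definition H_alg ::
    "('c::{finite, ab_group_add} \<Rightarrow> 'g::{finite, ab_group_add} \<Rightarrow> 'g \<Rightarrow> 'k::field)
      \<Rightarrow> ('g \<Rightarrow> 'c \<Rightarrow> 'g) \<Rightarrow> ('k, 'c \<times> 'g) hopf"
  where "H_alg \<tau> r = \<lparr>
    hmult = (\<lambda>F F'. \<Sum>x\<in>UNIV. \<Sum>y\<in>UNIV. bar (component F x * bullet r x (component F' y)) (x + y)),
    hone = bar 1 0,
    hcomult = (\<lambda>F. \<Sum>x\<in>UNIV. \<Sum>a\<in>UNIV. \<Sum>b\<in>UNIV. \<tau> x a b *s
      tlift (\<lambda>f1 f2. bar (f1 * axis a 1) x \<star> bar (f2 * axis b 1) x)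
        (hcomult fun_alg (component F x))),
    hcounit = (\<lambda>F. \<Sum>x\<in>UNIV. component F x $ 0)\<rparr>"

definition H_ext ::
    "('c::{finite, ab_group_add} \<Rightarrow> 'g::{finite, ab_group_add} \<Rightarrow> 'g \<Rightarrow> 'k::field)
      \<Rightarrow> ('g \<Rightarrow> 'c \<Rightarrow> 'g) \<Rightarrow> ('k, 'c, 'g, 'c \<times> 'g) ext"
  where "H_ext \<tau> r =
    (H_alg \<tau> r, \<lambda>f. bar f 0, \<lambda>F. \<Sum>x\<in>UNIV. hcounit fun_alg (component F x) *s axis x 1)"

text \<open>
  Equivalence classes are formed among extensions with underlying space \<open>'k^('c \<times> 'g)\<close>: every
  extension has this dimension, so its structure can be transported there.
\<close>

definition Ext ::
    "('g::{finite, ab_group_add} \<Rightarrow> 'c::{finite, ab_group_add} \<Rightarrow> 'g)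
      \<Rightarrow> ('k::field, 'c, 'g, 'c \<times> 'g) ext set set"
  where "Ext r = {ext_equiv `` {H_ext \<tau> r'} | \<tau> r'. r' \<in> act_class r \<and> \<tau> \<in> carrier (Z2_c r')}"

definition noncocomm_Ext ::
    "('g::{finite, ab_group_add} \<Rightarrow> 'c::{finite, ab_group_add} \<Rightarrow> 'g)
      \<Rightarrow> ('k::field, 'c, 'g, 'c \<times> 'g) ext set set"
  where "noncocomm_Ext r = {X \<in> Ext r. \<forall>E\<in>X. \<not> cocommutative (fst E)}"

definition class_hopf_iso ::
    "(('k::field, 'c::finite, 'g::finite, 'b::finite) ext set \<times> ('k, 'c, 'g, 'b) ext set) set"
  where "class_hopf_iso = {(X, Y). \<exists>E\<in>X. \<exists>E'\<in>Y. hopf_isomorphic (fst E) (fst E')}"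

text \<open>
  The quotient consists of the sets \<open>R `` {X}\<close>, so the relation \<open>R\<close> is first restricted to the
  classes under consideration.
\<close>

definition noncocomm_iso_classes ::
    "('g::{finite, ab_group_add} \<Rightarrow> 'c::{finite, ab_group_add} \<Rightarrow> 'g)
      \<Rightarrow> ('k::field, 'c, 'g, 'c \<times> 'g) ext set set set"
  where "noncocomm_iso_classes r =
    noncocomm_Ext r // (class_hopf_iso \<inter> noncocomm_Ext r \<times> noncocomm_Ext r)"

end

theory Submission
  imports Defs
begin

text \<open>
  In coordinates on \<open>'c \<times> 'g\<close> the comultiplication maps the summand with index \<open>x\<close> to its own
  tensor square, twisted by \<open>\<tau> x\<close>. Since \<open>'c\<close> has prime order and \<open>\<tau>\<close> is a cocycle in its first
  argument, in the noncocommutative case \<open>\<tau> x\<close> is nonsymmetric for every \<open>x \<noteq> 0\<close>. Summands with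
  nonsymmetric \<open>\<tau> x\<close> contain no nonzero cocommutative subcoalgebra, so the functions on \<open>'g\<close> are
  the largest one. Hence every Hopf isomorphism preserves them and induces an automorphism of \<open>'g\<close>;
  comparing comultiplications shows that it permutes the summands by an automorphism of \<open>'c\<close> and
  scales them by a 1-cochain whose coboundary is the quotient of the two cocycles. Over an
  algebraically closed field symmetric cocycles on \<open>'g\<close> are trivial, so the cocommutative extensions
  are exactly those with class in \<open>H2_cc\<close>, and the orbit count is the classification of isomorphisms.
\<close>

section \<open>Linear maps and tensors in coordinates\<close>

text \<open>Isomorphisms are analysed through their matrix in the basis
  \<open>axis (x, s) 1\<close>, the delta function at s in the summand x. Being a coalgebra map
  becomes one family of scalar identities; being an algebra map on the summand 0 says that delta
  functions go to orthogonal idempotents. With nonsymmetry these force a monomial matrix, with one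
  nonzero entry per row: the positions of the entries give the two automorphisms, their values give
  the cochain.

  The orbit count needs no map between quotients built by hand. Orbits and isomorphism classes are
  both images of one set, the nonsymmetric cocycles for the fixed action \<open>r\<close>, and the
  isomorphism criterion says that the two images have the same fibres. Extensions over another
  action in the class are reached because twisting along an isomorphism of actions moves their
  cocycle to \<open>r\<close> and keeps the Hopf algebra up to isomorphism.\<close>

lemma linear_vec_iff:
  "Vector_Spaces.linear (*s) (*s) (f :: 'k::field ^ 'b::finite \<Rightarrow> 'k ^ 'c::finite) \<longleftrightarrow>
    (\<forall>v w. f (v + w) = f v + f w) \<and> (\<forall>c v. f (c *s v) = c *s f v)"
  by (auto simp: Vector_Spaces.linear_iff vec.vector_space_axioms)

lemma linear_functional_iff:
  "Vector_Spaces.linear (*s) (*) (f :: 'k::field ^ 'b::finite \<Rightarrow> 'k) \<longleftrightarrow>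
    (\<forall>v w. f (v + w) = f v + f w) \<and> (\<forall>c v. f (c *s v) = c * f v)"
proof -
  have "vector_space ((*) :: 'k \<Rightarrow> 'k \<Rightarrow> 'k)"
    by unfold_locales (auto simp: algebra_simps)
  then show ?thesis
    by (auto simp: Vector_Spaces.linear_iff vec.vector_space_axioms)
qed

lemma tensor_nth [simp]: "(v \<star> w) $ (b, c) = v $ b * w $ c"
  by (simp add: tensor_def)

lemma tlift_nth: "tlift f t $ i = (\<Sum>b\<in>UNIV. \<Sum>c\<in>UNIV. t $ (b, c) * f (axis b 1) (axis c 1) $ i)"
  by (simp add: tlift_def)

lemma tensor_map_nth:
  "tensor_map f g t $ (d, e) =
    (\<Sum>b\<in>UNIV. \<Sum>c\<in>UNIV. t $ (b, c) * (f (axis b 1) $ d * g (axis c 1) $ e))"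
  by (simp add: tensor_map_def tlift_nth)

lemma linear_nth:
  assumes "Vector_Spaces.linear (*s) (*s) (f :: 'k::field ^ 'b::finite \<Rightarrow> 'k ^ 'c::finite)"
  shows "f v $ i = (\<Sum>j\<in>UNIV. v $ j * f (axis j 1) $ i)"
proof -
  have "f v = f (\<Sum>j\<in>UNIV. v $ j *s axis j 1)" by (simp add: basis_expansion)
  also have "\<dots> = (\<Sum>j\<in>UNIV. v $ j *s f (axis j 1))"
    by (simp only: vec.linear_sum[OF assms] vec.linear_scale[OF assms])
  finally show ?thesis by simp
qed

lemma sum_delta_mult [simp]:
  fixes h :: "'a::finite \<Rightarrow> 'k::semiring_1"
  shows "(\<Sum>j\<in>UNIV. h j * (if j = i then 1 else 0)) = h i"
    "(\<Sum>j\<in>UNIV. h j * (if i = j then 1 else 0)) = h i"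
    "(\<Sum>j\<in>UNIV. (if j = i then 1 else 0) * h j) = h i"
    "(\<Sum>j\<in>UNIV. (if i = j then 1 else 0) * h j) = h i"
  by (simp_all add: if_distrib[of "\<lambda>z. z * _"] if_distrib[of "\<lambda>z. _ * z"] cong: if_cong)

lemma axis_nth_if: "axis i x $ j = (if j = i then x else 0)"
  by (simp add: axis_def)

lemma sum_swap_pairs:
  "(\<Sum>a\<in>A. \<Sum>b\<in>B. \<Sum>c\<in>C. \<Sum>d\<in>D. F a b c d) = (\<Sum>c\<in>C. \<Sum>d\<in>D. \<Sum>a\<in>A. \<Sum>b\<in>B. F a b c d)"
proof -
  have "(\<Sum>a\<in>A. \<Sum>b\<in>B. \<Sum>c\<in>C. \<Sum>d\<in>D. F a b c d) = (\<Sum>a\<in>A. \<Sum>c\<in>C. \<Sum>d\<in>D. \<Sum>b\<in>B. F a b c d)"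
    by (intro sum.cong refl, subst sum.swap, intro sum.cong refl, rule sum.swap)
  also have "\<dots> = (\<Sum>c\<in>C. \<Sum>d\<in>D. \<Sum>a\<in>A. \<Sum>b\<in>B. F a b c d)"
    by (subst sum.swap, intro sum.cong refl, rule sum.swap)
  finally show ?thesis .
qed

text \<open>\<open>tensor_map\<close> evaluates its maps on basis vectors only. Linearity is asked
  of the outer maps, because they are applied to the vectors \<open>f' (axis b' 1)\<close> and
  \<open>g' (axis c' 1)\<close>, which have to be expanded in the basis.\<close>

lemma tensor_map_comp:
  assumes "Vector_Spaces.linear (*s) (*s) f" "Vector_Spaces.linear (*s) (*s) g"
  shows "tensor_map f g (tensor_map f' g' t) = tensor_map (f \<circ> f') (g \<circ> g') t"
proof -
  have "tensor_map f g (tensor_map f' g' t) $ (d, e) = tensor_map (f \<circ> f') (g \<circ> g') t $ (d, e)" for d e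
  proof -
    have "tensor_map f g (tensor_map f' g' t) $ (d, e) = (\<Sum>b\<in>UNIV. \<Sum>c\<in>UNIV. \<Sum>b'\<in>UNIV. \<Sum>c'\<in>UNIV.
       t $ (b', c') * (f' (axis b' 1) $ b * f (axis b 1) $ d) * (g' (axis c' 1) $ c * g (axis c 1) $ e))"
      by (simp add: tensor_map_nth sum_distrib_right sum_distrib_left mult.assoc mult.left_commute)
    also have "\<dots> = (\<Sum>b'\<in>UNIV. \<Sum>c'\<in>UNIV. \<Sum>b\<in>UNIV. \<Sum>c\<in>UNIV.
       t $ (b', c') * (f' (axis b' 1) $ b * f (axis b 1) $ d) * (g' (axis c' 1) $ c * g (axis c 1) $ e))"
      by (rule sum_swap_pairs)
    also have "\<dots> = (\<Sum>b'\<in>UNIV. \<Sum>c'\<in>UNIV. t $ (b', c') *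
        (f (f' (axis b' 1)) $ d * g (g' (axis c' 1)) $ e))"
    proof -
      have "f (f' v) $ d * g (g' w) $ e =
        (\<Sum>b\<in>UNIV. \<Sum>c\<in>UNIV. (f' v $ b * f (axis b 1) $ d) * (g' w $ c * g (axis c 1) $ e))" for v w
        by (subst linear_nth[OF assms(1), of "f' v"], subst linear_nth[OF assms(2), of "g' w"])
          (rule sum_product)
      then show ?thesis by (simp add: sum_distrib_left mult.assoc)
    qed
    finally show ?thesis by (simp add: tensor_map_nth)
  qed
  then show ?thesis by (auto simp: vec_eq_iff)
qed

lemma tensor_map_id: "tensor_map (\<lambda>x. x) (\<lambda>x. x) t = t"
  by (auto simp: vec_eq_iff tensor_map_nth axis_nth_if sum_distrib_left[symmetric]
      mult.assoc[symmetric] simp del: mult.assoc)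

section \<open>Hopf algebra isomorphisms\<close>

lemma linear_vec_ident: "Vector_Spaces.linear (*s) (*s) (\<lambda>x :: 'k::field ^ 'b::finite. x)"
  by (simp add: linear_vec_iff)

lemma hopf_iso_id: "hopf_iso H H (\<lambda>x. x)"
  by (simp add: hopf_iso_def hopf_hom_def tensor_map_id linear_vec_ident bij_id[unfolded id_def])

lemma hopf_hom_comp:
  assumes "hopf_hom H H' f" "hopf_hom H' H'' g"
  shows "hopf_hom H H'' (g \<circ> f)"
  using assms unfolding hopf_hom_def by (auto simp: tensor_map_comp linear_vec_iff)

lemma hopf_iso_comp:
  assumes "hopf_iso H H' f" "hopf_iso H' H'' g"
  shows "hopf_iso H H'' (g \<circ> f)"
  using assms hopf_hom_comp unfolding hopf_iso_def by (blast intro: bij_comp)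

lemma hopf_iso_inv:
  assumes "hopf_iso H H' f"
  shows "hopf_iso H' H (inv_into UNIV f)"
proof -
  have b: "bij f" and h: "hopf_hom H H' f" using assms by (auto simp: hopf_iso_def)
  have lin: "Vector_Spaces.linear (*s) (*s) f"
    and hom: "\<And>v w. f (hmult H v w) = hmult H' (f v) (f w)" "f (hone H) = hone H'"
     "\<And>v. hcomult H' (f v) = tensor_map f f (hcomult H v)" "\<And>v. hcounit H' (f v) = hcounit H v"
    using h by (auto simp: hopf_hom_def)
  have fi: "f (inv_into UNIV f v) = v" and ff: "inv_into UNIV f (f w) = w" for v w
    using b by (simp_all add: bij_is_surj surj_f_inv_f bij_is_inj)
  have lin': "Vector_Spaces.linear (*s) (*s) (inv_into UNIV f)"
    using lin fi ff unfolding linear_vec_iff by metis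
  have "inv_into UNIV f (hmult H' v w) = hmult H (inv_into UNIV f v) (inv_into UNIV f w)" for v w
    by (metis fi ff hom(1))
  moreover have "inv_into UNIV f (hone H') = hone H" by (metis ff hom(2))
  moreover have "hcomult H (inv_into UNIV f v) = tensor_map (inv_into UNIV f) (inv_into UNIV f) (hcomult H' v)" for v
  proof -
    have "inv_into UNIV f \<circ> f = (\<lambda>x. x)" using ff by auto
    then show ?thesis using hom(3)[of "inv_into UNIV f v"]
      by (simp add: fi tensor_map_comp lin' tensor_map_id)
  qed
  moreover have "hcounit H (inv_into UNIV f v) = hcounit H' v" for v by (metis fi hom(4))
  ultimately show ?thesis using lin' b by (simp add: hopf_iso_def hopf_hom_def bij_imp_bij_inv)
qed

lemma hopf_isomorphic_refl: "hopf_isomorphic H H"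
  unfolding hopf_isomorphic_def using hopf_iso_id by blast

lemma hopf_isomorphic_sym: "hopf_isomorphic H H' \<Longrightarrow> hopf_isomorphic H' H"
  unfolding hopf_isomorphic_def using hopf_iso_inv by blast

lemma hopf_isomorphic_trans:
  "hopf_isomorphic H H' \<Longrightarrow> hopf_isomorphic H' H'' \<Longrightarrow> hopf_isomorphic H H''"
  unfolding hopf_isomorphic_def using hopf_iso_comp by blast

text \<open>The tensor square of a map commutes with the flip of the two factors, and an isomorphism
  is onto.\<close>

lemma cocommutative_hopf_isomorphic:
  assumes "hopf_isomorphic H H'" "cocommutative H"
  shows "cocommutative H'"
proof -
  obtain f where f: "hopf_iso H H' f" using assms(1) by (auto simp: hopf_isomorphic_def)
  have "hcomult H' h $ (b, c) = hcomult H' h $ (c, b)" for h b c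
  proof -
    obtain v where "h = f v" using f by (metis bij_pointE hopf_iso_def)
    moreover have "tensor_map f f t $ (b, c) = tensor_map f f t $ (c, b)"
      if "\<And>b c. t $ (b, c) = t $ (c, b)" for t
      unfolding tensor_map_nth by (subst sum.swap) (simp add: that mult.commute)
    ultimately show ?thesis using f assms(2)
      by (simp add: hopf_iso_def hopf_hom_def cocommutative_def)
  qed
  then show ?thesis by (simp add: cocommutative_def)
qed

lemma equiv_ext_equiv:
  "equiv {E :: ('k::field, 'c::{finite, ab_group_add}, 'g::{finite, ab_group_add}, 'b::finite) ext.
     is_extension E} ext_equiv"
proof (rule equivI)
  show "ext_equiv \<subseteq> {E. is_extension E} \<times> {E. is_extension E}" by (auto simp: ext_equiv_def)
  show "refl_on {E. is_extension E} ext_equiv"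
    by (intro refl_onI) (auto simp: ext_equiv_def intro!: exI[of _ "\<lambda>x. x"] hopf_iso_id linear_vec_ident)
  show "sym ext_equiv"
  proof (rule symI)
    fix E E' assume E: "(E, E') \<in> ext_equiv"
    then obtain H \<iota> \<pi> H' \<iota>' \<pi>' f where *: "E = (H, \<iota>, \<pi>)" "E' = (H', \<iota>', \<pi>')"
      and f: "hopf_iso H H' f" "f \<circ> \<iota> = \<iota>'" "\<pi>' \<circ> f = \<pi>"
      by (auto simp: ext_equiv_def)
    have "bij f" using f(1) by (simp add: hopf_iso_def)
    then have "inv_into UNIV f \<circ> \<iota>' = \<iota>" "\<pi> \<circ> inv_into UNIV f = \<pi>'"
      using f(2,3) unfolding fun_eq_iff comp_apply by (metis bij_inv_eq_iff)+
    then show "(E', E) \<in> ext_equiv" using hopf_iso_inv[OF f(1)] E by (auto simp: * ext_equiv_def)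
  qed
  show "trans ext_equiv"
  proof (rule transI)
    fix E E' E'' assume E: "(E, E') \<in> ext_equiv" "(E', E'') \<in> ext_equiv"
    then obtain H \<iota> \<pi> H' \<iota>' \<pi>' H'' \<iota>'' \<pi>'' f g
      where *: "E = (H, \<iota>, \<pi>)" "E' = (H', \<iota>', \<pi>')" "E'' = (H'', \<iota>'', \<pi>'')"
      and f: "hopf_iso H H' f" "f \<circ> \<iota> = \<iota>'" "\<pi>' \<circ> f = \<pi>"
      and g: "hopf_iso H' H'' g" "g \<circ> \<iota>' = \<iota>''" "\<pi>'' \<circ> g = \<pi>'"
      by (auto simp: ext_equiv_def)
    have "(g \<circ> f) \<circ> \<iota> = \<iota>''" "\<pi>'' \<circ> (g \<circ> f) = \<pi>"
      using f(2,3) g(2,3) by (auto simp: fun_eq_iff)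
    then show "(E, E'') \<in> ext_equiv" using hopf_iso_comp[OF f(1) g(1)] E by (auto simp: * ext_equiv_def)
  qed
qed

section \<open>The algebras attached to cocycles\<close>

lemma sum_UNIV_prod:
  "(\<Sum>i\<in>(UNIV :: ('a::finite \<times> 'b::finite) set). h i) = (\<Sum>x\<in>UNIV. \<Sum>y\<in>UNIV. h (x, y))"
  by (simp add: sum.cartesian_product)

lemma mult_if_zero:
  "(if P then u else 0) * v = (if P then u * v else 0 :: 'k::semiring_0)"
  "v * (if P then u else 0) = (if P then v * u else 0 :: 'k::semiring_0)"
  by auto

lemma sum_if_const: "(\<Sum>j\<in>A. if P then h j else 0) = (if P then \<Sum>j\<in>A. h j else 0)"
  by simp

text \<open>Coordinates of basis vectors are written below as nested conditionals with default 0,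
  not as one conditional on a conjunction: \<open>sum.delta\<close> then collapses one sum per
  condition.\<close>

lemmas sum_if_zero_simps = mult_if_zero sum_if_const sum.delta sum.delta'

lemma action_zero [simp]: "is_action r \<Longrightarrow> r a 0 = a"
  and action_add: "is_action r \<Longrightarrow> r a (x + y) = r (r a x) y"
  and action_hom: "is_action r \<Longrightarrow> r (a + b) x = r a x + r b x"
  by (auto simp: is_action_def)

lemma action_zero_left [simp]: "is_action r \<Longrightarrow> r 0 x = 0"
  using action_hom[of r 0 0 x] by simp

lemma action_minus: "is_action r \<Longrightarrow> r (- a) x = - r a x"
  using action_hom[of r a "- a" x] by (simp add: eq_neg_iff_add_eq_0 add.commute)

lemma action_cancel [simp]: "is_action r \<Longrightarrow> r (r a x) (- x) = a" "is_action r \<Longrightarrow> r (r a (- x)) x = a"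
  by (simp_all flip: action_add)

lemma action_eq_iff: "is_action r \<Longrightarrow> r a x = b \<longleftrightarrow> a = r b (- x)"
  by auto

lemma Z2_c_D:
  assumes "\<tau> \<in> carrier (Z2_c r)"
  shows "\<tau> x a b \<noteq> 0" "\<tau> 0 a b = 1" "\<tau> x 0 b = 1" "\<tau> x a 0 = 1"
    "\<tau> x a (b + c) * \<tau> x b c = \<tau> x (a + b) c * \<tau> x a b"
    "\<tau> (x + y) a b = \<tau> x a b * \<tau> y (r a x) (r b x)"
  using assms by (auto simp: Z2_c_def)

text \<open>The cocycle identity at a, -a, a, together with normalization. It reconciles the scalar
  in the antipode with the one that the right antipode axiom produces.\<close>

lemma Z2_c_minus: "\<tau> \<in> carrier (Z2_c r) \<Longrightarrow> \<tau> x (- a) a = \<tau> x a (- a)"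
  using Z2_c_D(5)[of \<tau> r x a "- a" a] by (simp add: Z2_c_D)

section \<open>Structure constants of \<open>H_alg\<close> in coordinates\<close>

context
  fixes \<tau> :: "'c::{finite, ab_group_add} \<Rightarrow> 'g::{finite, ab_group_add} \<Rightarrow> 'g \<Rightarrow> 'k::field"
    and r :: "'g \<Rightarrow> 'c \<Rightarrow> 'g"
begin

lemma H_mult_nth:
  "hmult (H_alg \<tau> r) F F' $ (z, a) = (\<Sum>x\<in>UNIV. F $ (x, a) * F' $ (z - x, r a x))"
proof -
  have *: "(z = x + y) = (y = z - x)" for x y :: 'c by (auto simp: algebra_simps)
  show ?thesis
    by (simp add: H_alg_def bar_def component_def bullet_def * if_distrib cong: if_cong)
qed

lemma H_mult_axis_nth:
  "hmult (H_alg \<tau> r) (axis (x, c) 1) (axis (y, d) 1) $ (z, a) =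
    (if c = a then if y = z - x then if d = r a x then 1 else 0 else 0 else 0)"
proof -
  have "axis (u, c) 1 $ (v, a) = (if v = u then if c = a then 1 else 0 else 0 :: 'k)" for u v :: 'c
    by (auto simp: axis_nth_if)
  moreover have "axis (u, d) 1 $ (v, e) = (if u = v then if d = e then 1 else 0 else 0 :: 'k)"
    for u v :: 'c and e by (auto simp: axis_nth_if)
  ultimately show ?thesis
    by (simp only: H_mult_nth mult_if_zero(1) mult_1_left mult_zero_left) (simp add: eq_commute)
qed

lemma H_one_nth: "hone (H_alg \<tau> r) $ (z, a) = (if z = 0 then 1 else 0)"
  by (simp add: H_alg_def bar_def)

lemma H_counit: "hcounit (H_alg \<tau> r) F = (\<Sum>x\<in>UNIV. F $ (x, 0))"
  by (simp add: H_alg_def component_def)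

text \<open>The vanishing for x \<noteq> y makes every summand a subcoalgebra; the summand x is dual
  to the group algebra of 'g twisted by \<open>\<tau> x\<close>.\<close>

lemma H_comult_nth:
  "hcomult (H_alg \<tau> r) F $ ((x, a), (y, b)) = (if x = y then \<tau> x a b * F $ (x, a + b) else 0)"
proof -
  have "bar (axis c 1 * axis d 1) u $ (z, e) =
      (if u = z then if c = e then if d = e then 1 else 0 else 0 else 0 :: 'k)" for c d e :: 'g and u z :: 'c
    by (auto simp: bar_def axis_nth_if)
  then show ?thesis
    by (simp add: H_alg_def component_def fun_alg_def tlift_nth sum_distrib_left sum_if_zero_simps)
qed

lemma H_linear:
  "Vector_Spaces.linear (*s) (*s) (hmult (H_alg \<tau> r) F)"
  "Vector_Spaces.linear (*s) (*s) (\<lambda>F. hmult (H_alg \<tau> r) F F')"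
  "Vector_Spaces.linear (*s) (*s) (hcomult (H_alg \<tau> r))"
  "Vector_Spaces.linear (*s) (*) (hcounit (H_alg \<tau> r))"
  by (auto simp: linear_vec_iff linear_functional_iff vec_eq_iff H_mult_nth H_comult_nth H_counit
      algebra_simps sum.distrib sum_distrib_left)

lemma H_tensor_mult_nth:
  "tensor_mult (H_alg \<tau> r) s t $ ((z, a), (w, b)) =
    (\<Sum>x\<in>UNIV. \<Sum>y\<in>UNIV. s $ ((x, a), (y, b)) * t $ ((z - x, r a x), (w - y, r b y)))"
  by (simp add: tensor_mult_def tlift_nth sum_UNIV_prod H_mult_axis_nth sum_if_zero_simps)

end

section \<open>Bialgebra axioms from the two cocycle identities\<close>

locale cocycle_data =
  fixes \<tau> :: "'c::{finite, ab_group_add} \<Rightarrow> 'g::{finite, ab_group_add} \<Rightarrow> 'g \<Rightarrow> 'k::field"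
    and r :: "'g \<Rightarrow> 'c \<Rightarrow> 'g"
  assumes action: "is_action r" and cocycle: "\<tau> \<in> carrier (Z2_c r)"
begin

abbreviation "H \<equiv> H_alg \<tau> r"

lemma sum_reindex_add: "(\<Sum>x\<in>UNIV. h x) = (\<Sum>x\<in>UNIV. h (x + y :: 'c))"
  by (rule sum.reindex_bij_witness[of _ "\<lambda>x. x + y" "\<lambda>x. x - y"]) auto

lemma H_algebra: "is_algebra H"
proof -
  have "hmult H (hmult H u v) w $ (z, a) = hmult H u (hmult H v w) $ (z, a)" for u v w z a
  proof -
    have "hmult H (hmult H u v) w $ (z, a) =
      (\<Sum>y\<in>UNIV. \<Sum>x\<in>UNIV. u $ (x, a) * v $ (y - x, r a x) * w $ (z - y, r a y))"
      by (simp add: H_mult_nth sum_distrib_right)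
    also have "\<dots> = (\<Sum>x\<in>UNIV. \<Sum>y\<in>UNIV. u $ (x, a) * v $ (y - x, r a x) * w $ (z - y, r a y))"
      by (rule sum.swap)
    also have "\<dots> = (\<Sum>x\<in>UNIV. \<Sum>y\<in>UNIV.
        u $ (x, a) * v $ (y + x - x, r a x) * w $ (z - (y + x), r a (y + x)))"
      by (intro sum.cong refl sum_reindex_add)
    also have "\<dots> = hmult H u (hmult H v w) $ (z, a)"
      by (simp add: H_mult_nth sum_distrib_left mult.assoc action_add[OF action] add.commute
          diff_diff_eq flip: action_add[OF action])
    finally show ?thesis .
  qed
  moreover have "hmult H (hone H) v $ (z, a) = v $ (z, a)" for v z a
    by (simp add: H_mult_nth H_one_nth sum_if_zero_simps action_zero[OF action])
  moreover have "hmult H v (hone H) $ (z, a) = v $ (z, a)" for v z a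
    by (simp add: H_mult_nth H_one_nth eq_commute[of _ z] sum_if_zero_simps)
  ultimately show ?thesis by (auto simp: is_algebra_def H_linear vec_eq_iff)
qed

lemma H_comult_axis_nth:
  "hcomult H (axis i 1) $ ((x, a), (y, b)) = (if x = y then if i = (x, a + b) then \<tau> x a b else 0 else 0)"
  by (auto simp: H_comult_nth axis_nth_if)

text \<open>Coassociativity is the cocycle identity in the arguments from 'g, and the counit laws
  are normalization in these arguments.\<close>

lemma H_coalgebra: "is_coalgebra H"
proof -
  have "tensor_map (hcomult H) id (hcomult H h) $ ((i, j), k) =
               tensor_map id (hcomult H) (hcomult H h) $ (i, (j, k))" for h i j k
  proof -
    obtain x a y b z c where ijk: "i = (x, a)" "j = (y, b)" "k = (z, c)" by (metis surj_pair)
    have "tensor_map (hcomult H) id (hcomult H h) $ ((i, j), k) =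
      (if x = y then hcomult H h $ ((x, a + b), (z, c)) * \<tau> x a b else 0)"
      unfolding ijk tensor_map_nth
      by (simp add: H_comult_axis_nth axis_nth_if[of _ _ "(z, c)"] sum_if_zero_simps)
    moreover have "tensor_map id (hcomult H) (hcomult H h) $ (i, (j, k)) =
      (if y = z then hcomult H h $ ((x, a), (y, b + c)) * \<tau> y b c else 0)"
      unfolding ijk tensor_map_nth
      by (simp add: H_comult_axis_nth axis_nth_if[of _ _ "(x, a)"] sum_if_zero_simps)
    ultimately show ?thesis
      using Z2_c_D(5)[OF cocycle, of x a b c]
      by (auto simp: H_comult_nth add.assoc mult_ac)
  qed
  moreover have "tlift (\<lambda>v w. hcounit H v *s w) (hcomult H h) $ (x, a) = h $ (x, a)"
    "tlift (\<lambda>v w. hcounit H w *s v) (hcomult H h) $ (x, a) = h $ (x, a)" for h x a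
  proof -
    have *: "hcounit H (axis (x, a) 1) = (if a = 0 then 1 else 0)" for x a
      by (auto simp: H_counit axis_nth_if)
    have **: "axis (y, b) 1 $ (x, a) = (if x = y then if b = a then 1 else 0 else 0 :: 'k)" for x y a b
      by (auto simp: axis_nth_if)
    show "tlift (\<lambda>v w. hcounit H v *s w) (hcomult H h) $ (x, a) = h $ (x, a)"
     by (simp add: tlift_nth sum_UNIV_prod H_comult_nth * ** sum_if_zero_simps Z2_c_D[OF cocycle])
    show "tlift (\<lambda>v w. hcounit H w *s v) (hcomult H h) $ (x, a) = h $ (x, a)"
     by (simp add: tlift_nth sum_UNIV_prod H_comult_nth * ** sum_if_zero_simps Z2_c_D[OF cocycle])
  qed
  ultimately show ?thesis unfolding is_coalgebra_def by (auto simp: H_linear vec_eq_iff)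
qed

text \<open>Multiplicativity of the comultiplication is the rule for \<open>\<tau> (x + y)\<close>,
  applied to the splitting z = x + (z - x) of the summand index. That the unit is group-like is
  \<open>\<tau> 0 a b = 1\<close>.\<close>

lemma H_bialgebra: "is_bialgebra H"
proof -
  have "hcomult H (hmult H v w) $ ((z, a), (z', b)) = tensor_mult H (hcomult H v) (hcomult H w) $ ((z, a), (z', b))"
    for v w z z' a b
  proof (cases "z = z'")
    case True
    have *: "\<tau> z' a b * (v $ (x, a + b) * w $ (z' - x, r (a + b) x)) =
        \<tau> x a b * v $ (x, a + b) * (\<tau> (z' - x) (r a x) (r b x) * w $ (z' - x, r a x + r b x))" for x
      using Z2_c_D(6)[OF cocycle, of x "z' - x" a b] by (simp add: action_hom[OF action])
    show ?thesis
      by (simp add: True H_comult_nth H_tensor_mult_nth H_mult_nth sum_distrib_left sum_if_zero_simps)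
        (intro sum.cong refl *)
  next
    case False
    then show ?thesis
      by (simp add: H_comult_nth H_tensor_mult_nth) (intro sum.neutral ballI, simp)
  qed
  moreover have "hcomult H (hone H) $ ((z, a), (z', b)) = (hone H \<star> hone H) $ ((z, a), (z', b))" for z z' a b
    by (simp add: H_comult_nth H_one_nth Z2_c_D[OF cocycle])
  moreover have "hcounit H (hone H) = 1" by (simp add: H_counit H_one_nth)
  moreover have "hcounit H (hmult H v w) = hcounit H v * hcounit H w" for v w
  proof -
    have "hcounit H (hmult H v w) = (\<Sum>z\<in>UNIV. \<Sum>x\<in>UNIV. v $ (x, 0) * w $ (z - x, 0))"
      by (simp add: H_counit H_mult_nth action_zero_left[OF action])
    also have "\<dots> = (\<Sum>x\<in>UNIV. \<Sum>z\<in>UNIV. v $ (x, 0) * w $ (z - x, 0))" by (rule sum.swap)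
    also have "\<dots> = (\<Sum>x\<in>UNIV. \<Sum>z\<in>UNIV. v $ (x, 0) * w $ (z + x - x, 0))"
      by (intro sum.cong refl sum_reindex_add)
    finally show ?thesis by (simp add: H_counit sum_product)
  qed
  ultimately show ?thesis
    by (auto simp: is_bialgebra_def H_algebra H_coalgebra vec_eq_iff)
qed

end

section \<open>Hopf isomorphisms versus pairs of automorphisms with a 1-cochain\<close>

section \<open>Isomorphisms between the extensions\<close>

lemma auto_add_grp_iff: "l \<in> auto add_grp \<longleftrightarrow> (\<forall>a b. l (a + b) = l a + l b) \<and> bij l"
  by (auto simp: auto_def hom_def Bij_def add_grp_def)

text \<open>On the element with all coordinates 1, the coproduct has the values of \<tau> themselves
  as its diagonal entries.\<close>

lemma cocommutative_H_iff:
  "cocommutative (H_alg \<tau> r) \<longleftrightarrow> (\<forall>x a b. \<tau> x a b = \<tau> x b a)"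
proof
  assume *: "cocommutative (H_alg \<tau> r)"
  have "hcomult (H_alg \<tau> r) (\<chi> i. 1) $ ((x, a), (x, b)) = hcomult (H_alg \<tau> r) (\<chi> i. 1) $ ((x, b), (x, a))" for x a b
    using * unfolding cocommutative_def by blast
  then show "\<forall>x a b. \<tau> x a b = \<tau> x b a" by (simp add: H_comult_nth)
qed (auto simp: cocommutative_def H_comult_nth add.commute)

text \<open>The map carries the summand x to the summand \<open>\<alpha> x\<close>, composes
  functions with the inverse of \<open>l\<close> and scales by \<eta>. The rule for
  \<open>\<eta> (x + y)\<close> and the equivariance of \<open>l\<close> give multiplicativity; the
  relation between \<tau>' and \<tau> is comultiplicativity, cleared of denominators in
  \<tau>''.\<close>

lemma hopf_iso_of_cochain:
  fixes \<tau> \<tau>' :: "'c::{finite, ab_group_add} \<Rightarrow> 'g::{finite, ab_group_add} \<Rightarrow> 'g \<Rightarrow> 'k::field"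
  assumes \<alpha>: "\<alpha> \<in> auto add_grp" and l: "l \<in> act_isos r (act_pow r' \<alpha>)"
    and \<eta>: "\<eta> \<in> cochains1" "\<And>x y a. \<eta> (x + y) a = \<eta> x a * \<eta> y (r' a x)"
    and \<tau>': "\<And>x a b. \<tau>' x a b = dG \<eta> x a b * twist l \<alpha> \<tau> x a b"
  shows "hopf_iso (H_alg \<tau> r) (H_alg \<tau>' r')
    (\<lambda>F. \<chi> i. \<eta> (fst i) (snd i) * F $ (inv_into UNIV \<alpha> (fst i), inv_into UNIV l (snd i)))"
    (is "hopf_iso ?H ?H' ?f")
proof -
  define \<beta> where "\<beta> = inv_into UNIV \<alpha>"
  define \<mu> where "\<mu> = inv_into UNIV l"
  have \<alpha>': "\<alpha> (x + y) = \<alpha> x + \<alpha> y" "\<alpha> (\<beta> x) = x" "\<beta> (\<alpha> x) = x" for x y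
    using \<alpha> by (auto simp: auto_add_grp_iff \<beta>_def bij_is_surj surj_f_inv_f bij_is_inj)
  have l': "l (a + b) = l a + l b" "l (\<mu> a) = a" "\<mu> (l a) = a" "l (r a x) = r' (l a) (\<alpha> x)" for a b x
    using l by (auto simp: act_isos_def act_pow_def auto_add_grp_iff \<mu>_def bij_is_surj surj_f_inv_f bij_is_inj)
  have \<beta>: "\<beta> (x + y) = \<beta> x + \<beta> y" for x y by (metis \<alpha>')
  have \<mu>: "\<mu> (a + b) = \<mu> a + \<mu> b" for a b by (metis l')
  have \<beta>0: "\<beta> 0 = 0" using \<beta>[of 0 0] by simp
  have \<mu>0: "\<mu> 0 = 0" using \<mu>[of 0 0] by simp
  have \<beta>d: "\<beta> (x - y) = \<beta> x - \<beta> y" for x y using \<beta>[of "x - y" y] by (simp add: algebra_simps)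
  have eqv: "\<mu> (r' a y) = r (\<mu> a) (\<beta> y)" for a y by (metis \<alpha>' l')
  have nz: "\<eta> x a \<noteq> 0" "\<eta> 0 a = 1" "\<eta> x 0 = 1" for x a using \<eta>(1) by (auto simp: cochains1_def)
  have \<tau>'': "\<tau>' x a b * \<eta> x (a + b) = \<eta> x a * \<eta> x b * \<tau> (\<beta> x) (\<mu> a) (\<mu> b)" for x a b
    using nz by (simp add: \<tau>' dG_def twist_def coc_pow_def coc_aut_def \<beta>_def \<mu>_def)
  have f: "?f F $ (x, a) = \<eta> x a * F $ (\<beta> x, \<mu> a)" for F x a by (simp add: \<beta>_def \<mu>_def)
  have bij\<beta>: "bij \<beta>" by (rule o_bij[of \<alpha>]) (auto simp: \<alpha>')
  have "bij ?f"
    by (rule o_bij[of "\<lambda>F. \<chi> i. F $ (\<alpha> (fst i), l (snd i)) / \<eta> (\<alpha> (fst i)) (l (snd i))"])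
      (auto simp: vec_eq_iff fun_eq_iff nz \<alpha>' l' simp flip: \<beta>_def \<mu>_def)
  moreover have "Vector_Spaces.linear (*s) (*s) ?f"
    by (auto simp: linear_vec_iff vec_eq_iff algebra_simps)
  moreover have "?f (hmult ?H v w) $ (z, a) = hmult ?H' (?f v) (?f w) $ (z, a)" for v w z a
  proof -
    have "?f (hmult ?H v w) $ (z, a) = (\<Sum>x\<in>UNIV. \<eta> z a * (v $ (x, \<mu> a) * w $ (\<beta> z - x, r (\<mu> a) x)))"
      unfolding f unfolding H_mult_nth by (rule sum_distrib_left)
    also have "\<dots> = (\<Sum>y\<in>UNIV. \<eta> z a * (v $ (\<beta> y, \<mu> a) * w $ (\<beta> z - \<beta> y, r (\<mu> a) (\<beta> y))))"
      by (rule sum.reindex_bij_betw[OF bij\<beta>, symmetric])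
    also have "\<dots> = hmult ?H' (?f v) (?f w) $ (z, a)"
      unfolding H_mult_nth unfolding f
    proof (intro sum.cong refl)
      fix y
      have "\<eta> z a = \<eta> y a * \<eta> (z - y) (r' a y)" using \<eta>(2)[of y "z - y" a] by simp
      then show "\<eta> z a * (v $ (\<beta> y, \<mu> a) * w $ (\<beta> z - \<beta> y, r (\<mu> a) (\<beta> y))) =
        \<eta> y a * v $ (\<beta> y, \<mu> a) * (\<eta> (z - y) (r' a y) * w $ (\<beta> (z - y), \<mu> (r' a y)))"
        by (simp add: eqv \<beta>d)
    qed
    finally show ?thesis .
  qed
  moreover have "?f (hone ?H) $ (z, a) = hone ?H' $ (z, a)" for z a
  proof -
    have "\<beta> z = 0 \<longleftrightarrow> z = 0" by (metis \<alpha>'(2) \<beta>0)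
    then show ?thesis unfolding f by (simp add: H_one_nth nz)
  qed
  moreover have "hcomult ?H' (?f v) $ ((x, a), (y, b)) = tensor_map ?f ?f (hcomult ?H v) $ ((x, a), (y, b))"
    for v x a y b
  proof -
    have "?f (axis i 1) $ (x, a) = (if i = (\<beta> x, \<mu> a) then \<eta> x a else 0)" for i x a
      unfolding f by (auto simp: axis_nth_if)
    then have "tensor_map ?f ?f (hcomult ?H v) $ ((x, a), (y, b)) =
      hcomult ?H v $ ((\<beta> x, \<mu> a), (\<beta> y, \<mu> b)) * (\<eta> x a * \<eta> y b)"
      by (simp add: tensor_map_nth sum_if_zero_simps)
    moreover have "\<beta> x = \<beta> y \<longleftrightarrow> x = y" by (metis \<alpha>'(2))
    ultimately show ?thesis using \<tau>''[of x a b]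
      by (simp only: H_comult_nth f) (auto simp: \<mu> mult_ac)
  qed
  moreover have "hcounit ?H' (?f v) = hcounit ?H v" for v
    unfolding H_counit unfolding f nz \<mu>0 mult_1 by (rule sum.reindex_bij_betw[OF bij\<beta>])
  ultimately show ?thesis
    unfolding hopf_iso_def hopf_hom_def by (simp add: vec_eq_iff del: vec_lambda_beta)
qed

text \<open>On the summand 0, \<open>f\<close> is composition with a bijection \<mu> of 'g, and
  \<open>l\<close> is its inverse. The rest of \<open>f\<close> is determined by the images of the
  elements \<open>bar 1 x\<close>: each of them is supported in one summand, whose index is
  \<open>\<alpha> x\<close>, and its coordinates there make up \<eta>.\<close>

lemma cochain_of_hopf_iso:
  fixes \<tau> \<tau>' :: "'c::{finite, ab_group_add} \<Rightarrow> 'g::{finite, ab_group_add} \<Rightarrow> 'g \<Rightarrow> 'k::field"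
  assumes "cocycle_data \<tau> r" "cocycle_data \<tau>' r'"
    and iso: "hopf_iso (H_alg \<tau> r) (H_alg \<tau>' r') f"
    and nonsym: "\<And>x. x \<noteq> 0 \<Longrightarrow> \<exists>a b. \<tau>' x a b \<noteq> \<tau>' x b a"
  obtains \<alpha> l \<eta> where "\<alpha> \<in> auto add_grp" "l \<in> act_isos r (act_pow r' \<alpha>)" "\<eta> \<in> cochains1"
    "\<And>x y a. \<eta> (x + y) a = \<eta> x a * \<eta> y (r' a x)"
    "\<And>x a b. \<tau>' x a b = dG \<eta> x a b * twist l \<alpha> \<tau> x a b"
proof -
  interpret A: cocycle_data \<tau> r by fact
  interpret B: cocycle_data \<tau>' r' by fact
  note Z = Z2_c_D(1-4)[OF A.cocycle] and Z' = Z2_c_D(1-4)[OF B.cocycle]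
  have lin: "Vector_Spaces.linear (*s) (*s) f"
    and mult: "\<And>v w. f (hmult A.H v w) = hmult B.H (f v) (f w)" and one: "f (hone A.H) = hone B.H"
    and comult: "\<And>v. hcomult B.H (f v) = tensor_map f f (hcomult A.H v)"
    and bij: "bij f"
    using iso by (auto simp: hopf_iso_def hopf_hom_def)
  define N where "N i j = f (axis j 1) $ i" for i j
  have f_nth: "f v $ i = (\<Sum>x\<in>UNIV. \<Sum>s\<in>UNIV. v $ (x, s) * N i (x, s))" for v i
    unfolding N_def by (subst linear_nth[OF lin]) (simp add: sum_UNIV_prod)
  have f0: "v = 0" if "\<And>i. f v $ i = 0" for v
  proof -
    have "f v = f 0" using that vec.linear_0[OF lin] by (simp add: vec_eq_iff)
    then show ?thesis using bij by (metis bij_pointE)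
  qed
  \<comment> \<open>Compatibility with the comultiplication at the basis vector (x, s), read at the
    entry ((y, a), (z, b)). The right side runs over the splittings s = c + (s - c).\<close>
  have COM: "(if y = z then \<tau>' y a b * N (y, a + b) (x, s) else 0) =
    (\<Sum>c\<in>UNIV. \<tau> x c (s - c) * (N (y, a) (x, c) * N (z, b) (x, s - c)))" for x y z a b s
  proof -
    have *: "hcomult A.H (axis (x, s) 1) $ ((u, c), (v, d)) =
      (if u = x then if v = x then if d = s - c then \<tau> x c d else 0 else 0 else 0)" for u v c d
      by (auto simp: A.H_comult_axis_nth algebra_simps)
    show ?thesis
      using arg_cong[OF comult[of "axis (x, s) 1"], of "\<lambda>t. t $ ((y, a), (z, b))"]
      by (simp add: H_comult_nth[of \<tau>' r'] tensor_map_nth sum_UNIV_prod * sum_if_zero_simps flip: N_def cong: if_cong)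
  qed
  \<comment> \<open>For the source summand 0 the right side of \<open>COM\<close> is an untwisted
    convolution, hence unchanged under swapping a and b, while the left side changes its factor from
    \<open>\<tau>' y a b\<close> to \<open>\<tau>' y b a\<close>. This kills the row a + b of the
    block; putting a + b as first argument of the same identity then kills every row d.\<close>
  have N0: "N (y, d) (0, s) = 0" if y: "y \<noteq> 0" for y d s
  proof -
    obtain a b where ab: "\<tau>' y a b \<noteq> \<tau>' y b a" using nonsym[OF y] by blast
    have c0: "\<tau>' y a b * N (y, a + b) (0, s) = (\<Sum>c\<in>UNIV. N (y, a) (0, c) * N (y, b) (0, s - c))" for a b s
      using COM[of y y a b 0 s] by (simp add: Z)
    have z: "N (y, a + b) (0, s) = 0" for s :: 'g
    proof -
      have "(\<Sum>c\<in>UNIV. N (y, a) (0, c) * N (y, b) (0, s - c)) = (\<Sum>c\<in>UNIV. N (y, b) (0, c) * N (y, a) (0, s - c))"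
        by (rule sum.reindex_bij_witness[of _ "\<lambda>c. s - c" "\<lambda>c. s - c"]) auto
      then have "\<tau>' y a b * N (y, a + b) (0, s) = \<tau>' y b a * N (y, a + b) (0, s)"
        using c0[of a b s] c0[of b a s] by (simp add: add.commute)
      then show ?thesis using ab by simp
    qed
    have "\<tau>' y (a + b) (d - (a + b)) * N (y, d) (0, s) = 0"
      using c0[of "a + b" "d - (a + b)" s] z by simp
    then show ?thesis using Z' by simp
  qed
  define m where "m s b = N (0, b) (0, s)" for s b
  have axis_mult: "hmult A.H (axis (0, s) 1) v $ (z, a) = (if a = s then v $ (z, a) else 0)" for s v z a
  proof -
    have "axis (0, s) 1 $ (x, a) = (if x = 0 then if a = s then 1 else 0 else 0 :: 'k)" for x :: 'c
      by (auto simp: axis_nth_if)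
    then show ?thesis by (simp add: H_mult_nth sum_if_zero_simps action_zero[OF A.action])
  qed
  have f_mult0: "hmult B.H (f (axis (0, s) 1)) v $ (y, b) = m s b * v $ (y, b)" for s v y b
  proof -
    have "N (x, b) (0, s) = (if x = 0 then m s b else 0)" for x using N0 by (simp add: m_def)
    then show ?thesis by (simp add: H_mult_nth sum_if_zero_simps action_zero[OF B.action] flip: N_def)
  qed
  have mm: "m s b * m t b = (if s = t then m s b else 0)" for s t b
  proof -
    have "hmult A.H (axis (0, s) 1) (axis (0, t) 1) = (if s = t then axis (0, s) 1 else 0)"
      by (auto simp: vec_eq_iff axis_mult axis_nth_if)
    then show ?thesis
      using arg_cong[OF mult[of "axis (0, s) 1" "axis (0, t) 1"], of "\<lambda>v. v $ (0, b)"]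
      by (auto simp: f_mult0 vec.linear_0[OF lin] m_def simp flip: N_def split: if_splits)
  qed
  have sum_m: "(\<Sum>s\<in>UNIV. m s b) = 1" for b
    using arg_cong[OF one, of "\<lambda>v. v $ (0, b)"]
    by (simp add: f_nth H_one_nth m_def sum_if_zero_simps)
  \<comment> \<open>For fixed b the scalars \<open>m s b\<close> are orthogonal idempotents of a
    field with sum 1, so exactly one of them is 1. This is the duality between algebra maps of
    function algebras and maps of the underlying sets.\<close>
  have "\<exists>t. \<forall>s. m s b = (if s = t then 1 else 0)" for b
  proof -
    obtain t where t: "m t b \<noteq> 0" using sum_m[of b] by (metis sum.neutral zero_neq_one)
    then have "m t b = 1" using mm[of t b t] by simp
    then have "m s b = (if s = t then 1 else 0)" for s using mm[of s b t] by (simp split: if_splits)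
    then show ?thesis by blast
  qed
  then obtain \<mu> where \<mu>: "\<And>s b. m s b = (if s = \<mu> b then 1 else 0)" by metis
  have \<mu>_add: "\<mu> (a + b) = \<mu> a + \<mu> b" for a b
  proof -
    have "m (\<mu> (a + b)) (a + b) = (\<Sum>c\<in>UNIV. m c a * m (\<mu> (a + b) - c) b)"
      using COM[of 0 0 a b 0 "\<mu> (a + b)"] by (simp add: Z Z' m_def)
    also have "\<dots> = (if \<mu> (a + b) - \<mu> a = \<mu> b then 1 else 0)"
      by (simp only: \<mu> mult_if_zero(1) mult_1_left) simp
    finally show ?thesis by (simp add: \<mu> algebra_simps split: if_splits)
  qed
  \<comment> \<open>A missed s would make \<open>f\<close> kill the delta function at s in the
    summand 0.\<close>
  have "s \<in> range \<mu>" for s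
  proof (rule ccontr)
    assume "s \<notin> range \<mu>"
    then have "m s b = 0" for b using \<mu> by auto
    then have "N (y, b) (0, s) = 0" for y b using N0 m_def by metis
    then have "axis (0 :: 'c, s) (1 :: 'k) = 0"
      by (intro f0) (metis N_def surj_pair)
    then show False by (simp add: axis_eq_0_iff)
  qed
  then have bij\<mu>: "bij \<mu>" using finite_UNIV_surj_inj[of \<mu>] by (auto simp: bij_def)
  \<comment> \<open>\<open>e x\<close> is \<open>bar 1 x\<close>. Its products with the delta
    functions of the summand 0 are the basis vectors of the summand x, so \<open>f\<close> is
    determined by \<mu> and the images \<open>w x\<close>.\<close>
  define e :: "'c \<Rightarrow> 'k ^ ('c \<times> 'g)" where "e x = (\<chi> i. if fst i = x then 1 else 0)" for x
  define w where "w x i = f (e x) $ i" for x i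
  have Nw: "N (y, b) (x, s) = (if s = \<mu> b then w x (y, b) else 0)" for y b x s
  proof -
    have "axis (x, s) 1 = hmult A.H (axis (0, s) 1) (e x)"
      by (auto simp: vec_eq_iff axis_mult e_def axis_nth_if)
    then have "N (y, b) (x, s) = m s b * w x (y, b)"
      by (simp add: N_def mult f_mult0 w_def)
    then show ?thesis by (simp add: \<mu>)
  qed
  have WW: "(if y = z then \<tau>' y a b * w x (y, a + b) else 0) =
    \<tau> x (\<mu> a) (\<mu> b) * w x (y, a) * w x (z, b)" for x y z a b
    using COM[of y z a b x "\<mu> (a + b)"] by (cases "y = z") (simp_all add: Nw \<mu>_add sum_if_zero_simps mult.assoc)
  have "\<exists>y b. w x (y, b) \<noteq> 0" for x
  proof (rule ccontr)
    assume "\<not> ?thesis"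
    then have "e x = 0" by (intro f0) (metis w_def surj_pair)
    then have "e x $ (x, 0) = 0" by simp
    then show False by (simp add: e_def)
  qed
  then obtain \<alpha> d where \<alpha>d: "\<And>x. w x (\<alpha> x, d x) \<noteq> 0" by metis
  \<comment> \<open>Off the diagonal the left side of \<open>WW\<close> is 0, and \<open>d x\<close>
    marks a nonzero coordinate in the summand \<open>\<alpha> x\<close>. Hence no other summand can
    contribute.\<close>
  have w0: "w x (y, a) = 0" if "y \<noteq> \<alpha> x" for x y a
    using WW[of y "\<alpha> x" a "d x" x] that \<alpha>d[of x] Z by simp
  \<comment> \<open>With b = d x - a the left side of \<open>WW\<close> is a nonzero multiple of the
    coordinate at \<open>d x\<close>, so the factor at a on the right cannot vanish.\<close>
  have w_nz: "w x (\<alpha> x, a) \<noteq> 0" for x a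
    using WW[of "\<alpha> x" "\<alpha> x" a "d x - a" x] \<alpha>d[of x] Z' by auto
  have \<mu>0: "\<mu> 0 = 0" using \<mu>_add[of 0 0] by simp
  have w_0: "w x (\<alpha> x, 0) = 1" for x
    using WW[of "\<alpha> x" "\<alpha> x" 0 0 x] w_nz[of x 0] by (simp add: Z Z' \<mu>0)
  have e_mult: "hmult A.H (e x) v $ (z, a) = v $ (z - x, r a x)" for x v z a
    by (simp add: H_mult_nth e_def sum_if_zero_simps)
  have f_mult: "hmult B.H (f (e x)) v $ (z, a) = w x (\<alpha> x, a) * v $ (z - \<alpha> x, r' a (\<alpha> x))" for x v z a
  proof -
    have "hmult B.H (f (e x)) v $ (z, a) =
      (\<Sum>u\<in>UNIV. if u = \<alpha> x then w x (u, a) * v $ (z - u, r' a u) else 0)"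
      unfolding H_mult_nth using w0 by (intro sum.cong) (auto simp: w_def)
    then show ?thesis by simp
  qed
  have w_add: "w (x + y) (z, a) = w x (\<alpha> x, a) * w y (z - \<alpha> x, r' a (\<alpha> x))" for x y z a
  proof -
    have "hmult A.H (e x) (e y) = e (x + y)"
      by (auto simp: vec_eq_iff e_mult) (auto simp: e_def algebra_simps)
    then show ?thesis using mult[of "e x" "e y"] by (simp add: w_def f_mult)
  qed
  have \<alpha>_add: "\<alpha> (x + y) = \<alpha> x + \<alpha> y" for x y
  proof -
    have "w y (\<alpha> (x + y) - \<alpha> x, r' 0 (\<alpha> x)) \<noteq> 0"
      using w_add[of x y "\<alpha> (x + y)" 0] w_nz[of "x + y" 0] by auto
    then have "\<alpha> (x + y) - \<alpha> x = \<alpha> y" using w0 by blast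
    then show ?thesis by (simp add: algebra_simps)
  qed
  have "y \<in> range \<alpha>" for y
  proof (rule ccontr)
    assume "y \<notin> range \<alpha>"
    then have "w x (y, b) = 0" for x b using w0 by blast
    then have "f v $ (y, 0) = 0" for v by (simp add: f_nth Nw cong: if_cong)
    moreover obtain v where "axis (y, 0) 1 = f v" using bij by (metis bij_pointE)
    ultimately show False by (metis axis_nth zero_neq_one)
  qed
  then have bij\<alpha>: "bij \<alpha>" using finite_UNIV_surj_inj[of \<alpha>] by (auto simp: bij_def)
  \<comment> \<open>Moving a delta function past \<open>bar 1 x\<close> translates its point. The
    point s is chosen so that the image of its delta function takes the value 1 at
    \<open>r' b (\<alpha> x)\<close>; the resulting nonzero entry of \<open>N\<close> forces
    \<open>r s (- x)\<close> to be \<open>\<mu> b\<close>.\<close>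
  have eqv: "\<mu> (r' b (\<alpha> x)) = r (\<mu> b) x" for b x
  proof -
    define s where "s = \<mu> (r' b (\<alpha> x))"
    have "hmult A.H (e x) (axis (0, s) 1) = axis (x, r s (- x)) 1"
      by (auto simp: vec_eq_iff e_mult axis_nth_if action_cancel[OF A.action])
    then have "N (\<alpha> x, b) (x, r s (- x)) = w x (\<alpha> x, b) * N (0, r' b (\<alpha> x)) (0, s)"
      using mult[of "e x" "axis (0, s) 1"] by (simp add: N_def f_mult)
    moreover have "N (0, r' b (\<alpha> x)) (0, s) = 1" using \<mu> by (simp add: s_def flip: m_def)
    ultimately have "r s (- x) = \<mu> b" using w_nz by (auto simp: Nw split: if_splits)
    then show ?thesis by (metis s_def action_cancel(2)[OF A.action])
  qed
  define \<beta> where "\<beta> = inv_into UNIV \<alpha>"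
  define l where "l = inv_into UNIV \<mu>"
  have \<beta>: "\<alpha> (\<beta> y) = y" "\<beta> (\<alpha> x) = x" for x y
    using bij\<alpha> by (simp_all add: \<beta>_def bij_is_surj surj_f_inv_f bij_is_inj)
  have l: "\<mu> (l y) = y" "l (\<mu> x) = x" for x y
    using bij\<mu> by (simp_all add: l_def bij_is_surj surj_f_inv_f bij_is_inj)
  have inv_l: "inv_into UNIV l = \<mu>" unfolding l_def by (rule inv_inv_eq[OF bij\<mu>])
  \<comment> \<open>Indexed by the target summand, which makes it a cochain for r'.\<close>
  define \<eta> where "\<eta> y a = w (\<beta> y) (y, a)" for y a
  have \<beta>_add: "\<beta> (x + y) = \<beta> x + \<beta> y" for x y by (metis \<beta> \<alpha>_add)
  have \<eta>_nz: "\<eta> y a \<noteq> 0" for y a using w_nz[of "\<beta> y" a] by (simp add: \<eta>_def \<beta>)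
  show ?thesis
  proof
    show "\<alpha> \<in> auto add_grp" by (simp add: auto_add_grp_iff \<alpha>_add bij\<alpha>)
    have "l (a + b) = l a + l b" for a b by (metis l \<mu>_add)
    moreover have "bij l" unfolding l_def by (rule bij_imp_bij_inv[OF bij\<mu>])
    moreover have "l (r a x) = r' (l a) (\<alpha> x)" for a x by (metis l eqv)
    ultimately show "l \<in> act_isos r (act_pow r' \<alpha>)" by (simp add: act_isos_def act_pow_def auto_add_grp_iff)
    have "e 0 = hone A.H" by (auto simp: vec_eq_iff e_def H_one_nth)
    then have w00: "w 0 (z, a) = (if z = 0 then 1 else 0)" for z a by (simp add: w_def one H_one_nth)
    moreover have "\<beta> 0 = 0" using \<beta>_add[of 0 0] by simp
    moreover have "\<eta> x 0 = 1" for x using w_0[of "\<beta> x"] by (simp add: \<eta>_def \<beta>)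
    ultimately show "\<eta> \<in> cochains1" using \<eta>_nz by (simp add: cochains1_def) (simp add: \<eta>_def)
    show "\<eta> (x + y) a = \<eta> x a * \<eta> y (r' a x)" for x y a
      using w_add[of "\<beta> x" "\<beta> y" "x + y" a] by (simp add: \<eta>_def \<beta> \<beta>_add)
    show "\<tau>' x a b = dG \<eta> x a b * twist l \<alpha> \<tau> x a b" for x a b
      using WW[of x x a b "\<beta> x"] \<eta>_nz
      by (simp add: dG_def twist_def coc_pow_def coc_aut_def inv_l divide_simps flip: \<eta>_def \<beta>_def)
  qed
qed

section \<open>Triviality of symmetric 2-cocycles over an algebraically closed field\<close>

section \<open>Symmetric cocycles\<close>

text \<open>The sequence \<open>u\<close> plays the part of the iterates of an operator on one
  vector. Take an annihilating polynomial q of least degree, split off a root c, and let q' be the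
  cofactor: by minimality the combination of the \<open>u i\<close> with coefficients q' is nonzero,
  and q = (X - c) q' says that the shift multiplies it by c.\<close>

lemma exists_shift_eigenvector:
  fixes u :: "nat \<Rightarrow> 'x \<Rightarrow> 'k::alg_closed_field"
  assumes n: "n > 0" "\<And>x. u n x = \<gamma> * u 0 x" and x0: "u 0 x0 \<noteq> 0"
  shows "\<exists>h c. (\<exists>x. (\<Sum>i<n. h i * u i x) \<noteq> 0) \<and>
    (\<forall>x. (\<Sum>i<n. h i * u (Suc i) x) = c * (\<Sum>i<n. h i * u i x))"
proof -
  define Q where "Q q \<longleftrightarrow> q \<noteq> 0 \<and> degree q \<le> n \<and> (\<forall>x. (\<Sum>i\<le>n. coeff q i * u i x) = 0)" for q :: "'k poly"
  \<comment> \<open>X^n - \<gamma> expresses the periodicity hypothesis, so annihilating polynomials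
    of degree at most n exist.\<close>
  define q0 where "q0 = monom 1 n - [:\<gamma>:]"
  have q0: "coeff q0 i = (if i = n then 1 else 0) - (if i = 0 then \<gamma> else 0)" for i
    by (simp add: q0_def coeff_pCons split: nat.split)
  have "coeff q0 n = 1" using n(1) by (simp add: q0)
  then have "q0 \<noteq> 0" by auto
  moreover have "degree q0 \<le> n" unfolding q0_def
    by (intro degree_diff_le) (auto simp: degree_monom_eq)
  moreover have "(\<Sum>i\<le>n. coeff q0 i * u i x) = 0" for x
    by (simp add: q0 left_diff_distrib sum_subtractf mult_if_zero n(2))
  ultimately have "Q q0" by (simp add: Q_def)
  then obtain q where q: "Q q" and min: "\<And>q'. Q q' \<Longrightarrow> degree q \<le> degree q'"
    using ex_has_least_nat[where P = Q and m = degree] by blast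
  have "degree q > 0"
  proof (rule ccontr)
    assume "\<not> degree q > 0"
    then obtain a where a: "q = [:a:]" by (metis degree_eq_zeroE gr0I)
    then have "(\<Sum>i\<le>n. coeff q i * u i x0) = (\<Sum>i\<le>n. if i = 0 then a * u i x0 else 0)"
      by (intro sum.cong refl) (simp add: coeff_pCons split: nat.split)
    then show False using q a x0 by (simp add: Q_def)
  qed
  then obtain c where "poly q c = 0" using alg_closed_imp_poly_has_root by blast
  then obtain q' where q': "q = [:- c, 1:] * q'" by (metis dvdE poly_eq_0_iff_dvd)
  have "q \<noteq> 0" using q by (simp add: Q_def)
  then have "q' \<noteq> 0" using q' by auto
  then have deg: "degree q = Suc (degree q')" unfolding q' by (subst degree_mult_eq) auto
  then have deg_n: "degree q' < n" using q by (simp add: Q_def)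
  have "\<not> Q q'" using min[of q'] deg by auto
  then obtain x where "(\<Sum>i\<le>n. coeff q' i * u i x) \<noteq> 0"
    using \<open>q' \<noteq> 0\<close> deg_n by (auto simp: Q_def)
  moreover have trunc: "(\<Sum>i\<le>n. coeff q' i * u i x) = (\<Sum>i<n. coeff q' i * u i x)" for x
    using coeff_eq_0[OF deg_n] by (simp add: lessThan_Suc_atMost[symmetric])
  moreover have "(\<Sum>i<n. coeff q' i * u (Suc i) x) = c * (\<Sum>i<n. coeff q' i * u i x)" for x
  proof -
    obtain m where m: "n = Suc m" using n(1) by (cases n) auto
    have "coeff q i = coeff (pCons 0 q') i - c * coeff q' i" for i by (simp add: q')
    then have "0 = (\<Sum>i\<le>n. coeff (pCons 0 q') i * u i x) - c * (\<Sum>i\<le>n. coeff q' i * u i x)"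
      using q by (simp add: Q_def left_diff_distrib sum_subtractf sum_distrib_left mult.assoc)
    also have "(\<Sum>i\<le>n. coeff (pCons 0 q') i * u i x) = (\<Sum>i<n. coeff q' i * u (Suc i) x)"
      unfolding m by (subst sum.atMost_Suc_shift) (simp add: lessThan_Suc_atMost)
    finally show ?thesis by (simp add: trunc)
  qed
  ultimately show ?thesis by (intro exI[of _ "coeff q'"] exI[of _ c]) auto
qed

text \<open>
  The twisted translations \<open>T a\<close> satisfy \<open>T a \<circ> T b = t a b T (a + b)\<close>, hence commute when \<open>t\<close> is
  symmetric; the eigenvalues of a common eigenvector trivialize \<open>t\<close>.
\<close>

lemma symmetric_cocycle_trivial:
  fixes t :: "'g::{finite, ab_group_add} \<Rightarrow> 'g \<Rightarrow> 'k::alg_closed_field"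
  assumes nz: "\<And>a b. t a b \<noteq> 0" and norm: "\<And>a. t a 0 = 1"
    and coc: "\<And>a b c. t a (b + c) * t b c = t (a + b) c * t a b"
    and sym: "\<And>a b. t a b = t b a"
  obtains \<psi> where "\<And>a. \<psi> a \<noteq> 0" "\<psi> 0 = 1" "\<And>a b. \<psi> a * \<psi> b = t a b * \<psi> (a + b)"
proof -
  define T where "T a v = (\<lambda>x. t x a * v (x + a))" for a and v :: "'g \<Rightarrow> 'k"
  have TT: "T a (T b v) x = t a b * T (a + b) v x" for a b v x
    using coc[of x a b] by (simp add: T_def add.assoc mult.assoc[symmetric]) (simp add: mult_ac)
  have comm: "T a (T b v) = T b (T a v)" for a b v
    by (auto simp: TT sym[of a b] add.commute[of a b])
  \<comment> \<open>Induction on the set of simultaneously diagonalized operators. For a new element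
    a, an eigenvector of \<open>T a\<close> is sought among the combinations of the iterates of
    \<open>T a\<close> on the old common eigenvector; there every earlier \<open>T b\<close> still
    acts by \<open>\<psi> b\<close>, since it commutes with \<open>T a\<close>.\<close>
  have "\<exists>v \<psi>. v \<noteq> (\<lambda>x. 0) \<and> (\<forall>a\<in>A. \<forall>x. T a v x = \<psi> a * v x)" for A :: "'g set"
  proof (induction A rule: finite_induct[OF finite])
    case 1
    show ?case by (intro exI[of _ "\<lambda>x. 1"]) (simp add: fun_eq_iff)
  next
    case (2 a A)
    then obtain v \<psi> where v: "v \<noteq> (\<lambda>x. 0)" "\<And>b x. b \<in> A \<Longrightarrow> T b v x = \<psi> b * v x" by auto
    define u where "u i = (T a ^^ i) v" for i
    have u_Suc: "u (Suc i) = T a (u i)" and u0: "u 0 = v" for i by (simp_all add: u_def)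
    have "\<exists>s. \<forall>x. u i x = s * T (((+) a ^^ i) 0) v x" for i
    proof (induction i)
      case 0
      show ?case by (intro exI[of _ 1]) (simp add: u0 T_def norm)
    next
      case (Suc i)
      then obtain s where s: "\<And>x. u i x = s * T (((+) a ^^ i) 0) v x" by blast
      have "u (Suc i) x = s * T a (T (((+) a ^^ i) 0) v) x" for x
        unfolding u_Suc T_def[of a] s by simp
      then show ?case by (intro exI[of _ "s * t a (((+) a ^^ i) 0)"]) (simp add: TT)
    qed
    \<comment> \<open>A multiple n a = 0 exists by finiteness, and it makes the n-th iterate of
      \<open>T a\<close> on v a scalar multiple of v.\<close>
    moreover obtain n where n0: "n > 0" "((+) a ^^ n) 0 = 0"
    proof (rule funpow_inj_finite[of "(+) a" 0])
      show "inj ((+) a)" by (rule inj_onI) simp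
      show "finite {y. \<exists>n. y = ((+) a ^^ n) 0}" by simp
    qed blast
    ultimately obtain s where s: "\<forall>x. u n x = s * T (((+) a ^^ n) 0) v x" by blast
    have n: "n > 0" "\<And>x. u n x = s * u 0 x" using n0 s by (simp_all add: T_def norm u0)
    obtain x0 where x0: "u 0 x0 \<noteq> 0" using v(1) by (auto simp: u0)
    obtain h c x1 where h: "(\<Sum>i<n. h i * u i x1) \<noteq> 0"
      "\<And>x. (\<Sum>i<n. h i * u (Suc i) x) = c * (\<Sum>i<n. h i * u i x)"
      using exists_shift_eigenvector[of n u s x0, OF n x0] by auto
    define w where "w x = (\<Sum>i<n. h i * u i x)" for x
    have Tw: "T b w x = (\<Sum>i<n. h i * T b (u i) x)" for b x
      by (simp add: T_def w_def sum_distrib_left mult.left_commute)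
    have "T b (u i) x = \<psi> b * u i x" if b: "b \<in> A" for b i x
    proof (induction i arbitrary: x)
      case (Suc i)
      have "T b (u (Suc i)) x = T a (T b (u i)) x" unfolding u_Suc by (simp add: comm)
      also have "\<dots> = t x a * (\<psi> b * u i (x + a))" unfolding T_def[of a] by (simp add: Suc)
      finally show ?case by (simp add: u_Suc T_def)
    qed (simp add: u0 v b)
    then have "T b w x = \<psi> b * w x" if "b \<in> A" for b x
      using that by (simp add: Tw) (simp add: w_def sum_distrib_left mult.left_commute)
    moreover have "T a w x = c * w x" for x
      using h(2)[of x] by (simp add: Tw w_def flip: u_Suc)
    moreover have "w \<noteq> (\<lambda>x. 0)" using h(1) by (auto simp: w_def fun_eq_iff)
    ultimately show ?case using \<open>a \<notin> A\<close> by (intro exI[of _ w] exI[of _ "\<psi>(a := c)"]) auto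
  qed
  from this[of UNIV] obtain v \<psi> where v: "v \<noteq> (\<lambda>x. 0)" "\<And>a x. T a v x = \<psi> a * v x" by auto
  from v(1) obtain x where x: "v x \<noteq> 0" by blast
  have mult: "\<psi> a * \<psi> b = t a b * \<psi> (a + b)" for a b
  proof -
    have "T a (T b v) x = \<psi> b * T a v x" unfolding T_def[of a] by (simp add: v(2))
    then have "(\<psi> a * \<psi> b) * v x = (t a b * \<psi> (a + b)) * v x"
      by (auto simp: TT v(2) mult_ac)
    then show ?thesis using x by simp
  qed
  have "\<psi> 0 = 1" using v(2)[of 0 x] x by (simp add: T_def norm)
  \<comment> \<open>The product of \<open>\<psi> a\<close> and \<open>\<psi> (- a)\<close> is the
    nonzero value \<open>t a (- a)\<close>.\<close>
  moreover have "\<psi> a \<noteq> 0" for a using mult[of a "- a"] nz[of a "- a"] \<open>\<psi> 0 = 1\<close> by auto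
  ultimately show ?thesis using mult by (intro that[of \<psi>])
qed

definition symmetric :: "('c \<Rightarrow> 'g \<Rightarrow> 'g \<Rightarrow> 'k) \<Rightarrow> bool" where
  "symmetric \<tau> \<longleftrightarrow> (\<forall>x a b. \<tau> x a b = \<tau> x b a)"

lemma B2_cc_iff:
  fixes \<tau> :: "'c::ab_group_add \<Rightarrow> 'g::{finite, ab_group_add} \<Rightarrow> 'g \<Rightarrow> 'k::alg_closed_field"
  assumes \<tau>: "\<tau> \<in> carrier (Z2_c r)"
  shows "\<tau> \<in> B2_cc r \<longleftrightarrow> symmetric \<tau>"
proof
  assume "\<tau> \<in> B2_cc r"
  then show "symmetric \<tau>" by (auto simp: B2_cc_def symmetric_def dG_def add.commute mult.commute)
next
  assume sym: "symmetric \<tau>"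
  have "\<exists>\<psi>. (\<forall>a. \<psi> a \<noteq> 0) \<and> \<psi> 0 = 1 \<and> (\<forall>a b. \<psi> a * \<psi> b = \<tau> x a b * \<psi> (a + b))" for x
    using symmetric_cocycle_trivial[of "\<tau> x"] Z2_c_D[OF \<tau>] sym unfolding symmetric_def by metis
  then obtain \<psi> where \<psi>: "\<And>x a. \<psi> x a \<noteq> 0" "\<And>x. \<psi> x 0 = 1"
    "\<And>x a b. \<psi> x a * \<psi> x b = \<tau> x a b * \<psi> x (a + b)" by metis
  \<comment> \<open>The trivialization found at x = 0 may be any character of 'g. Overwriting it by
    1 gives the required normalization and stays correct because \<open>\<tau> 0\<close> is
    1.\<close>
  define \<eta> where "\<eta> x a = (if x = 0 then 1 else \<psi> x a)" for x a
  have "\<eta> \<in> cochains1" using \<psi> by (simp add: cochains1_def \<eta>_def)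
  moreover have "\<tau> = dG \<eta>"
    by (auto simp: fun_eq_iff dG_def \<eta>_def \<psi> Z2_c_D(2)[OF \<tau>])
  ultimately show "\<tau> \<in> B2_cc r" using \<tau> by (auto simp: B2_cc_def)
qed

section \<open>Groups of prime order\<close>

lemma group_add_grp: "group (add_grp :: 'a::ab_group_add monoid)"
proof (rule groupI)
  fix x :: 'a assume "x \<in> carrier add_grp"
  show "\<exists>y\<in>carrier add_grp. y \<otimes>\<^bsub>add_grp\<^esub> x = \<one>\<^bsub>add_grp\<^esub>"
    by (intro bexI[of _ "- x"]) (auto simp: add_grp_def)
qed (auto simp: add_grp_def add.assoc)

lemma subgroup_prime_UNIV:
  fixes S :: "'c::{finite, ab_group_add} set"
  assumes p: "prime CARD('c)" and "0 \<in> S" and plus: "\<And>x y. x \<in> S \<Longrightarrow> y \<in> S \<Longrightarrow> x + y \<in> S"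
    and minus: "\<And>x. x \<in> S \<Longrightarrow> - x \<in> S" and x: "x \<in> S" "x \<noteq> 0"
  shows "S = UNIV"
proof -
  interpret group "add_grp :: 'c monoid" by (rule group_add_grp)
  have inv: "inv\<^bsub>add_grp\<^esub> x = - x" for x :: 'c
    by (rule inv_equality) (auto simp: add_grp_def)
  have "subgroup S add_grp"
    by (rule subgroupI) (use assms in \<open>auto simp: inv\<close>, auto simp: add_grp_def)
  from lagrange[OF this] have "card S dvd CARD('c)"
    by (metis (no_types, lifting) add_grp_def dvd_triv_right order_def partial_object.select_convs(1))
  then have "card S = 1 \<or> card S = CARD('c)" using p by (metis prime_nat_iff)
  moreover have "card S \<noteq> 1" using x \<open>0 \<in> S\<close> by (metis card_1_singletonE singletonD)
  ultimately show ?thesis by (simp add: card_eq_UNIV_imp_eq_UNIV)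
qed

text \<open>The x with symmetric \<open>\<tau> x\<close> form a subgroup: by the rule for
  \<open>\<tau> (x + y)\<close>, sums multiply symmetric functions, and \<open>\<tau> (- y)\<close>
  is the inverse of \<open>\<tau> y\<close> at translated arguments.\<close>

lemma not_symmetric_pointwise:
  fixes \<tau> :: "'c::{finite, ab_group_add} \<Rightarrow> 'g::{finite, ab_group_add} \<Rightarrow> 'g \<Rightarrow> 'k::field"
  assumes "prime CARD('c)" "is_action r" "\<tau> \<in> carrier (Z2_c r)" "\<not> symmetric \<tau>" "x \<noteq> 0"
  shows "\<exists>a b. \<tau> x a b \<noteq> \<tau> x b a"
proof (rule ccontr)
  assume x: "\<nexists>a b. \<tau> x a b \<noteq> \<tau> x b a"
  note Z = Z2_c_D[OF assms(3)]
  have "{x. \<forall>a b. \<tau> x a b = \<tau> x b a} = UNIV"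
  proof (rule subgroup_prime_UNIV[OF assms(1) _ _ _ _ assms(5)])
    fix y assume y: "y \<in> {x. \<forall>a b. \<tau> x a b = \<tau> x b a}"
    have "\<tau> (- y) a b = \<tau> (- y) b a" for a b
    proof -
      have "\<tau> (- y) a b * \<tau> y (r a (- y)) (r b (- y)) = 1" for a b
        using Z(6)[of "- y" y a b] Z(2) by simp
      from this[of a b] this[of b a]
      have "\<tau> (- y) a b * \<tau> y (r a (- y)) (r b (- y)) = \<tau> (- y) b a * \<tau> y (r b (- y)) (r a (- y))"
        by simp
      moreover have "\<tau> y (r b (- y)) (r a (- y)) = \<tau> y (r a (- y)) (r b (- y))" using y by blast
      ultimately show ?thesis using Z(1) by simp
    qed
    then show "- y \<in> {x. \<forall>a b. \<tau> x a b = \<tau> x b a}" by blast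
  qed (use x in \<open>auto simp: Z(2,6)\<close>)
  then show False using assms(4) by (auto simp: symmetric_def)
qed

text \<open>The elements acting trivially form a subgroup. Faithfulness makes the definite
  description in \<open>GG_act\<close> meaningful.\<close>

lemma nontrivial_action_faithful:
  fixes r :: "'g::ab_group_add \<Rightarrow> 'c::{finite, ab_group_add} \<Rightarrow> 'g"
  assumes "prime CARD('c)" "is_action r" "\<not> trivial_action r" "\<And>a. r a x = r a y"
  shows "x = y"
proof (rule ccontr)
  assume "x \<noteq> y"
  have "{x. \<forall>a. r a x = a} = UNIV"
  proof (rule subgroup_prime_UNIV[OF assms(1)])
    show "x - y \<in> {x. \<forall>a. r a x = a}"
    proof clarify
      fix a
      have "r a (x - y) = r (r a x) (- y)" using action_add[OF assms(2), of a x "- y"] by simp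
      then show "r a (x - y) = a" by (simp add: assms(4) action_cancel[OF assms(2)])
    qed
    fix z assume "z \<in> {x. \<forall>a. r a x = a}"
    then show "- z \<in> {x. \<forall>a. r a x = a}"
      using action_cancel(1)[OF assms(2), of _ z] by auto
  qed (use \<open>x \<noteq> y\<close> in \<open>auto simp: action_zero[OF assms(2)] action_add[OF assms(2)]\<close>)
  then show False using assms(3) by (auto simp: trivial_action_def)
qed

section \<open>Antipode, normality and the kernel condition\<close>

section \<open>The extension attached to a cocycle\<close>

context cocycle_data
begin

text \<open>On basis vectors, (y, c) goes to (- y, - r c y) with the factor
  \<open>1 / \<tau> y c (- c)\<close>; the definition is this map read in coordinates.\<close>

definition antip :: "'k ^ ('c \<times> 'g) \<Rightarrow> 'k ^ ('c \<times> 'g)" where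
  "antip F = (\<chi> i. F $ (- fst i, - r (snd i) (fst i)) /
     \<tau> (- fst i) (- r (snd i) (fst i)) (r (snd i) (fst i)))"

lemma antip_nth: "antip F $ (x, a) = F $ (- x, - r a x) / \<tau> (- x) (- r a x) (r a x)"
  by (simp add: antip_def)

lemma antip_axis:
  "antip (axis (y, c) 1) $ (x, a) = (if x = - y then if a = - r c y then 1 / \<tau> y c (- c) else 0 else 0)"
proof -
  have "(- x, - r a x) = (y, c) \<longleftrightarrow> x = - y \<and> a = - r c y"
  proof
    assume "(- x, - r a x) = (y, c)"
    then have "y = - x" "c = r (- a) x" by (auto simp: action_minus[OF action])
    then show "x = - y \<and> a = - r c y" by (simp add: action_cancel[OF action])
  next
    assume "x = - y \<and> a = - r c y"
    then have "x = - y" "a = r (- c) y" by (auto simp: action_minus[OF action])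
    then show "(- x, - r a x) = (y, c)" by (simp add: action_cancel[OF action])
  qed
  then show ?thesis
    by (auto simp: antip_nth axis_nth_if action_minus[OF action] action_cancel[OF action])
qed

lemma H_antipode: "is_antipode H antip"
proof -
  have lin: "Vector_Spaces.linear (*s) (*s) antip"
    by (auto simp: linear_vec_iff vec_eq_iff antip_nth add_divide_distrib)
  have nz: "\<tau> y a b \<noteq> 0" for y a b by (rule Z2_c_D(1)[OF cocycle])
  have pair: "axis (u, c) 1 $ (v, a) = (if v = u then if a = c then 1 else 0 else 0 :: 'k)" for u v :: 'c and a c
    by (auto simp: axis_nth_if)
  have left: "hmult H (antip (axis (y, c) 1)) (axis (y, d) 1) $ (z, a) =
     (if z = 0 then if d = r a (- y) then if c = - d then 1 / \<tau> y (- d) d else 0 else 0 else 0)"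
    for y c d z a
  proof -
    have "hmult H (antip (axis (y, c) 1)) (axis (y, d) 1) $ (z, a) =
      (\<Sum>x\<in>UNIV. if x = - y then if a = - r c y then if z = 0 then if d = r a (- y)
        then 1 / \<tau> y c (- c) else 0 else 0 else 0 else 0)"
      unfolding H_mult_nth by (intro sum.cong refl) (simp add: antip_axis pair)
    moreover have "a = - r c y \<longleftrightarrow> - c = r a (- y)"
      using action_eq_iff[OF action, of "- c" y a] by (auto simp: action_minus[OF action])
    ultimately show ?thesis by (simp cong: if_cong) (metis minus_minus)
  qed
  have right: "hmult H (axis (y, c) 1) (antip (axis (y, d) 1)) $ (z, a) =
     (if z = 0 then if c = a then if d = - a then 1 / \<tau> y a (- a) else 0 else 0 else 0)" for y c d z a
  proof -
    have "hmult H (axis (y, c) 1) (antip (axis (y, d) 1)) $ (z, a) =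
      (\<Sum>x\<in>UNIV. if x = y then if c = a then if z = 0 then if r a y = - r d y
        then 1 / \<tau> y d (- d) else 0 else 0 else 0 else 0)"
      unfolding H_mult_nth by (intro sum.cong refl) (simp add: antip_axis pair)
    moreover have "r a y = - r d y \<longleftrightarrow> d = - a"
      by (metis action_minus[OF action] action_cancel(1)[OF action] minus_minus)
    ultimately show ?thesis using Z2_c_minus[OF cocycle, of y a] by (simp cong: if_cong)
  qed
  have "tlift (\<lambda>v w. hmult H (antip v) w) (hcomult H h) $ (z, a) = (hcounit H h *s hone H) $ (z, a)"
    "tlift (\<lambda>v w. hmult H v (antip w)) (hcomult H h) $ (z, a) = (hcounit H h *s hone H) $ (z, a)" for h z a
    by (simp_all add: tlift_nth sum_UNIV_prod H_comult_nth left right sum_if_zero_simps H_counit H_one_nth nz)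
  then show ?thesis using lin by (auto simp: is_antipode_def vec_eq_iff)
qed

lemma H_hopf_algebra: "is_hopf_algebra H"
  using H_bialgebra H_antipode by (auto simp: is_hopf_algebra_def)

text \<open>The algebra is graded by 'c: products add degrees, the antipode negates them, and the
  coproduct of degree x lies in degree x on both sides. An adjoint action of degree x therefore maps
  degree 0 to degree x + 0 - x or - x + 0 + x, and the range in question is the part of degree
  0.\<close>

lemma H_normal: "normal_in (range (\<lambda>f. bar f 0)) H"
proof -
  have range: "F \<in> range (\<lambda>f. bar f 0) \<longleftrightarrow> (\<forall>x a. x \<noteq> 0 \<longrightarrow> F $ (x, a) = 0)" for F :: "'k ^ ('c \<times> 'g)"
  proof
    assume "\<forall>x a. x \<noteq> 0 \<longrightarrow> F $ (x, a) = 0"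
    then have "F = bar (component F 0) 0" by (auto simp: vec_eq_iff bar_def component_def)
    then show "F \<in> range (\<lambda>f. bar f 0)" by blast
  qed (auto simp: bar_def)
  define supp where "supp x F \<longleftrightarrow> (\<forall>y a. y \<noteq> x \<longrightarrow> F $ (y, a) = 0)" for x and F :: "'k ^ ('c \<times> 'g)"
  have mult: "supp (x + y) (hmult H F F')" if "supp x F" "supp y F'" for x y F F'
    unfolding supp_def H_mult_nth
  proof (intro allI impI sum.neutral ballI)
    fix z a u assume "z \<noteq> x + y"
    then have "z - u \<noteq> y" if "u = x" using that by (auto simp: algebra_simps)
    then show "F $ (u, a) * F' $ (z - u, r a u) = 0"
      using that by (cases "u = x") (simp_all add: supp_def)
  qed
  have antip: "supp (- x) (antip F)" if "supp x F" for x F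
    unfolding supp_def antip_nth
  proof (intro allI impI)
    fix y a assume "y \<noteq> - x"
    then have "- y \<noteq> x" by (metis minus_minus)
    then show "F $ (- y, - r a y) / \<tau> (- y) (- r a y) (r a y) = 0" using that by (simp add: supp_def)
  qed
  have ax: "supp x (axis (x, a) 1)" for x a by (auto simp: supp_def axis_nth_if)
  have lift: "tlift f (hcomult H h) \<in> range (\<lambda>f. bar f 0)"
    if "\<And>x a b. supp 0 (f (axis (x, a) 1) (axis (x, b) 1))" for f h
    unfolding range tlift_nth
  proof (intro allI impI sum.neutral ballI)
    fix z e i j assume "z \<noteq> (0 :: 'c)"
    then show "hcomult H h $ (i, j) * f (axis i 1) (axis j 1) $ (z, e) = 0"
      using that[of "fst i" "snd i" "snd j"]
      by (cases i; cases j) (auto simp: H_comult_nth supp_def)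
  qed
  have "supp 0 (bar f 0)" for f by (auto simp: supp_def bar_def)
  then have "supp 0 (hmult H (hmult H (axis (x, a) 1) (bar f 0)) (antip (axis (x, b) 1)))"
     "supp 0 (hmult H (hmult H (antip (axis (x, a) 1)) (bar f 0)) (axis (x, b) 1))" for x a b f
    using mult[OF mult[OF ax[of x] , of 0], of "bar f 0" "- x"]
      mult[OF mult[OF antip[OF ax[of x]] , of 0], of "bar f 0" x] ax antip[OF ax]
    by simp_all
  then show ?thesis
    unfolding normal_in_def using H_antipode by (intro exI[of _ antip]) (auto intro!: lift)
qed

lemma bar_nth: "bar f x $ (y, a) = (if y = x then f $ a else 0)"
  by (simp add: bar_def)

lemma H_incl: "hopf_hom fun_alg H (\<lambda>f. bar f 0)"
proof -
  have *: "bar (axis a 1) 0 $ (x, b) = (if x = 0 then if a = b then 1 else 0 else 0 :: 'k)"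
    for x :: 'c and a b :: 'g by (simp add: bar_nth axis_nth_if)
  have **: "axis a 1 $ b = (if a = b then 1 else 0 :: 'k)" for a b :: 'g by (simp add: axis_nth_if)
  show ?thesis
    unfolding hopf_hom_def linear_vec_iff
    by (auto simp: vec_eq_iff bar_nth fun_alg_def H_mult_nth H_one_nth H_comult_nth H_counit * ** tensor_map_nth
        sum_if_zero_simps action_zero[OF action] Z2_c_D[OF cocycle])
qed

definition "proj = (\<lambda>F :: 'k ^ ('c \<times> 'g). \<Sum>x\<in>UNIV. hcounit fun_alg (component F x) *s axis x 1)"

lemma proj_nth: "proj F $ x = F $ (x, 0)"
  by (simp add: proj_def fun_alg_def component_def axis_nth_if)

lemma H_proj: "hopf_hom H grp_alg proj"
proof -
  have m: "hmult grp_alg u v $ z = (\<Sum>x\<in>UNIV. u $ x * v $ (z - x))" for u v :: "('k, 'c) vec" and z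
  proof -
    have "(z = x + y) = (y = z - x)" for x y :: 'c by (auto simp: algebra_simps)
    then show ?thesis by (simp add: grp_alg_def axis_nth_if)
  qed
  have c: "hcomult grp_alg u $ (x, y) = (if x = y then u $ x else 0)" for u :: "('k, 'c) vec" and x y
  proof -
    have "(axis z 1 \<star> axis z 1) $ (x, y) = (if x = z then if y = z then 1 else 0 else 0 :: 'k)" for z :: 'c
      by (simp add: axis_nth_if)
    then show ?thesis by (simp add: grp_alg_def sum_if_zero_simps)
  qed
  have *: "proj (axis (z, a) 1) $ x = (if x = z then if a = 0 then 1 else 0 else 0)" for z a x
    by (auto simp: proj_nth axis_nth_if)
  have "hcomult grp_alg (proj v) $ (x, y) = tensor_map proj proj (hcomult H v) $ (x, y)" for v x y
    by (simp add: c tensor_map_nth sum_UNIV_prod H_comult_nth * sum_if_zero_simps Z2_c_D[OF cocycle])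
      (simp add: proj_nth)
  moreover have "hcounit grp_alg (proj v) = hcounit H v" for v
    by (simp add: H_counit grp_alg_def proj_nth)
  moreover have "hone grp_alg $ x = (if x = 0 then 1 else 0 :: 'k)" for x :: 'c
    by (simp add: grp_alg_def axis_nth_if)
  ultimately show ?thesis
    unfolding hopf_hom_def linear_vec_iff
    by (auto simp: vec_eq_iff proj_nth m H_mult_nth action_zero_left[OF action] H_one_nth)
qed

text \<open>\<open>ext_equiv\<close> relates extensions only, so without this fact the class of
  \<open>H_ext \<tau> r\<close> would be empty.\<close>

lemma H_extension: "is_extension (H_ext \<tau> r)"
proof -
  have 1: "inj (\<lambda>f :: ('k, 'g) vec. bar f (0 :: 'c))"
  proof (rule injI)
    fix f g :: "('k, 'g) vec" assume "bar f (0 :: 'c) = bar g 0"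
    then have "bar f 0 $ (0 :: 'c, a) = bar g 0 $ (0 :: 'c, a)" for a by simp
    then show "f = g" by (simp add: vec_eq_iff bar_nth)
  qed
  have 2: "surj proj"
  proof (rule surjI)
    fix u :: "('k, 'c) vec"
    show "proj (\<chi> i. u $ fst i) = u" by (simp add: vec_eq_iff proj_nth)
  qed
  have "{h. proj h = 0} = vec.span {hmult H a h | a h. a \<in> range (\<lambda>f. bar f 0) \<and> hcounit H a = 0}"
    (is "_ = vec.span ?S")
  proof
    show "{h. proj h = 0} \<subseteq> vec.span ?S"
    proof
      fix h assume "h \<in> {h. proj h = 0}"
      then have h: "h $ (x, 0) = 0" for x using proj_nth[of h x] by simp
      \<comment> \<open>This is 1 minus the delta function at 0. It has counit 0 and acts as a left
        identity on every element of the kernel, since these vanish at all points (x, 0).\<close>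
      let ?a = "bar (\<chi> a. if a = 0 then 0 else 1) 0"
      have "h = hmult H ?a h"
        by (auto simp: vec_eq_iff H_mult_nth bar_nth sum_if_zero_simps h action_zero[OF action])
      moreover have "hcounit H ?a = 0" by (simp add: H_counit bar_nth)
      ultimately have "h \<in> ?S" by blast
      then show "h \<in> vec.span ?S" by (rule vec.span_base)
    qed
    show "vec.span ?S \<subseteq> {h. proj h = 0}"
    proof (rule vec.span_minimal)
      show "vec.subspace {h. proj h = 0}"
        unfolding vec.subspace_def by (auto simp: vec_eq_iff proj_nth)
      show "?S \<subseteq> {h. proj h = 0}"
      proof clarify
        fix f h assume "hcounit H (bar f 0) = 0"
        then have "f $ 0 = 0" by (simp add: H_counit bar_nth)
        then show "proj (hmult H (bar f 0) h) = 0"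
          by (auto simp: vec_eq_iff proj_nth H_mult_nth bar_nth sum_if_zero_simps)
      qed
    qed
  qed
  then show ?thesis
    using H_hopf_algebra H_incl H_proj 1 2 H_normal
    by (simp add: is_extension_def H_ext_def proj_def)
qed

end

section \<open>Cohomology classes and twisting\<close>

lemma Z2_c_simps [simp]:
  "(\<sigma> \<otimes>\<^bsub>Z2_c r\<^esub> \<tau>) = (\<lambda>x a b. \<sigma> x a b * \<tau> x a b)" "\<one>\<^bsub>Z2_c r\<^esub> = (\<lambda>x a b. 1)"
  by (simp_all add: Z2_c_def)

lemma Z2_c_I:
  assumes "\<And>x a b. \<tau> x a b \<noteq> 0" "\<And>a b. \<tau> 0 a b = 1" "\<And>x b. \<tau> x 0 b = 1" "\<And>x a. \<tau> x a 0 = 1"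
    "\<And>x a b c. \<tau> x a (b + c) * \<tau> x b c = \<tau> x (a + b) c * \<tau> x a b"
    "\<And>x y a b. \<tau> (x + y) a b = \<tau> x a b * \<tau> y (r a x) (r b x)"
  shows "\<tau> \<in> carrier (Z2_c r)"
  using assms by (auto simp: Z2_c_def)

lemma mult_Z2_c:
  assumes "\<sigma> \<in> carrier (Z2_c r)" "\<tau> \<in> carrier (Z2_c r)"
  shows "(\<lambda>x a b. \<sigma> x a b * \<tau> x a b) \<in> carrier (Z2_c r)"
proof (rule Z2_c_I)
  show "\<sigma> x a (b + c) * \<tau> x a (b + c) * (\<sigma> x b c * \<tau> x b c) =
    \<sigma> x (a + b) c * \<tau> x (a + b) c * (\<sigma> x a b * \<tau> x a b)" for x a b c
    using arg_cong2[OF Z2_c_D(5)[OF assms(1)] Z2_c_D(5)[OF assms(2)], of "(*)" x a b c x a b c]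
    by (simp add: mult_ac)
  show "\<sigma> (x + y) a b * \<tau> (x + y) a b = \<sigma> x a b * \<tau> x a b * (\<sigma> y (r a x) (r b x) * \<tau> y (r a x) (r b x))" for x y a b
    by (simp add: Z2_c_D(6)[OF assms(1)] Z2_c_D(6)[OF assms(2)] mult_ac)
qed (simp_all add: Z2_c_D(1-4)[OF assms(1)] Z2_c_D(1-4)[OF assms(2)])

lemma inverse_Z2_c:
  assumes "\<tau> \<in> carrier (Z2_c r)"
  shows "(\<lambda>x a b. inverse (\<tau> x a b)) \<in> carrier (Z2_c r)"
proof (rule Z2_c_I)
  show "inverse (\<tau> x a (b + c)) * inverse (\<tau> x b c) = inverse (\<tau> x (a + b) c) * inverse (\<tau> x a b)" for x a b c
    using Z2_c_D(5)[OF assms, of x a b c] by (metis inverse_mult_distrib)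
  show "inverse (\<tau> (x + y) a b) = inverse (\<tau> x a b) * inverse (\<tau> y (r a x) (r b x))" for x y a b
    by (simp add: Z2_c_D(6)[OF assms])
qed (simp_all add: Z2_c_D(1-4)[OF assms])

lemma group_Z2_c: "group (Z2_c r)"
proof (rule groupI)
  fix \<tau> assume \<tau>: "\<tau> \<in> carrier (Z2_c r)"
  show "\<exists>\<sigma>\<in>carrier (Z2_c r). \<sigma> \<otimes>\<^bsub>Z2_c r\<^esub> \<tau> = \<one>\<^bsub>Z2_c r\<^esub>"
    by (rule bexI[OF _ inverse_Z2_c[OF \<tau>]]) (simp add: Z2_c_D(1)[OF \<tau>])
qed (auto simp: mult_Z2_c mult.assoc intro!: Z2_c_I)

lemma B2_c_subset_Z2_c:
  assumes r: "is_action r"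
  shows "B2_c r \<subseteq> carrier (Z2_c r)"
proof
  fix \<tau> assume "\<tau> \<in> B2_c r"
  then obtain \<eta> where \<tau>: "\<tau> = dG \<eta>" and \<eta>: "\<eta> \<in> cochains1" "\<And>x y a. \<eta> (x + y) a = \<eta> x a * \<eta> y (r a x)"
    by (auto simp: B2_c_def)
  have nz: "\<eta> x a \<noteq> 0" "\<eta> 0 a = 1" "\<eta> x 0 = 1" for x a using \<eta>(1) by (auto simp: cochains1_def)
  show "\<tau> \<in> carrier (Z2_c r)"
    unfolding \<tau>
  proof (rule Z2_c_I)
    show "dG \<eta> x a (b + c) * dG \<eta> x b c = dG \<eta> x (a + b) c * dG \<eta> x a b" for x a b c
      using nz by (simp add: dG_def add.assoc)
    show "dG \<eta> (x + y) a b = dG \<eta> x a b * dG \<eta> y (r a x) (r b x)" for x y a b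
      by (simp add: dG_def \<eta>(2) action_hom[OF r] mult_ac)
  qed (simp_all add: dG_def nz)
qed

lemma subgroup_B2_c:
  fixes r :: "'g::ab_group_add \<Rightarrow> 'c::ab_group_add \<Rightarrow> 'g"
  assumes r: "is_action r"
  shows "subgroup (B2_c r) (Z2_c r :: ('c \<Rightarrow> 'g \<Rightarrow> 'g \<Rightarrow> 'k::field) monoid)" (is "subgroup ?B ?Z")
proof -
  interpret group ?Z by (rule group_Z2_c)
  show ?thesis
  proof (rule subgroupI)
    show "?B \<subseteq> carrier ?Z" by (rule B2_c_subset_Z2_c[OF r])
    have "dG (\<lambda>x a. 1) \<in> ?B"
      unfolding B2_c_def cochains1_def by (intro CollectI exI[of _ "\<lambda>x a. 1"]) auto
    then show "?B \<noteq> {}" by blast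
  next
    fix \<tau> assume B: "\<tau> \<in> ?B"
    then obtain \<eta> where \<tau>: "\<tau> = dG \<eta>" and \<eta>: "\<eta> \<in> cochains1" "\<And>x y a. \<eta> (x + y) a = \<eta> x a * \<eta> y (r a x)"
      by (auto simp: B2_c_def)
    have Z: "\<tau> \<in> carrier ?Z" using B B2_c_subset_Z2_c[OF r] by blast
    have "inv\<^bsub>?Z\<^esub> \<tau> = (\<lambda>x a b. inverse (\<tau> x a b))"
      by (rule inv_equality) (use Z inverse_Z2_c[OF Z] in \<open>auto simp: Z2_c_D(1)[OF Z]\<close>)
    also have "\<dots> = dG (\<lambda>x a. inverse (\<eta> x a))"
      by (simp add: \<tau> dG_def)
    also have "\<dots> \<in> ?B"
      using \<eta> unfolding B2_c_def cochains1_def by (intro CollectI exI[of _ "\<lambda>x a. inverse (\<eta> x a)"]) auto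
    finally show "inv\<^bsub>?Z\<^esub> \<tau> \<in> ?B" .
  next
    fix \<tau> \<sigma> assume "\<tau> \<in> ?B" "\<sigma> \<in> ?B"
    then obtain \<eta> \<zeta> where \<tau>: "\<tau> = dG \<eta>" "\<sigma> = dG \<zeta>"
      and \<eta>: "\<eta> \<in> cochains1" "\<And>x y a. \<eta> (x + y) a = \<eta> x a * \<eta> y (r a x)"
        "\<zeta> \<in> cochains1" "\<And>x y a. \<zeta> (x + y) a = \<zeta> x a * \<zeta> y (r a x)"
      by (auto simp: B2_c_def)
    have "\<tau> \<otimes>\<^bsub>?Z\<^esub> \<sigma> = dG (\<lambda>x a. \<eta> x a * \<zeta> x a)"
      by (simp add: \<tau> dG_def mult_ac)
    also have "\<dots> \<in> ?B"
      using \<eta>(1,3) unfolding B2_c_def cochains1_def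
      by (intro CollectI exI[of _ "\<lambda>x a. \<eta> x a * \<zeta> x a"]) (auto simp: \<eta>(2,4))
    finally show "\<tau> \<otimes>\<^bsub>?Z\<^esub> \<sigma> \<in> ?B" .
  qed
qed

lemma cls_eq: "cls r \<tau> = {\<lambda>x a b. \<beta> x a b * \<tau> x a b | \<beta>. \<beta> \<in> B2_c r}"
  by (auto simp: cls_def r_coset_def)

lemma cls_eq_iff:
  assumes "is_action r" "\<tau> \<in> carrier (Z2_c r)" "\<sigma> \<in> carrier (Z2_c r)"
  shows "cls r \<sigma> = cls r \<tau> \<longleftrightarrow> \<sigma> \<in> cls r \<tau>"
proof -
  interpret group "Z2_c r" by (rule group_Z2_c)
  show ?thesis
    using repr_independence[OF _ assms(2) subgroup_B2_c[OF assms(1)]]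
      rcos_self[OF assms(3) subgroup_B2_c[OF assms(1)]]
    unfolding cls_def by metis
qed

lemma cls_self: "is_action r \<Longrightarrow> \<tau> \<in> carrier (Z2_c r) \<Longrightarrow> \<tau> \<in> cls r \<tau>"
  using cls_eq_iff by blast

lemma carrier_H2_c: "carrier (H2_c r) = cls r ` carrier (Z2_c r)"
  by (auto simp: H2_c_def FactGroup_def RCOSETS_def cls_def)

lemma carrier_H2_cc: "carrier (H2_cc r) = cls r ` B2_cc r"
  by (auto simp: H2_cc_def FactGroup_def RCOSETS_def cls_def r_coset_def)

lemma symmetric_B2_c: "\<beta> \<in> B2_c r \<Longrightarrow> symmetric \<beta>"
  by (auto simp: B2_c_def symmetric_def dG_def add.commute mult.commute)

text \<open>Coboundaries are symmetric, so symmetry depends only on the class of the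
  cocycle.\<close>

lemma cls_in_H2_cc_iff:
  fixes \<tau> :: "'c::ab_group_add \<Rightarrow> 'g::{finite, ab_group_add} \<Rightarrow> 'g \<Rightarrow> 'k::alg_closed_field"
  assumes r: "is_action r" and \<tau>: "\<tau> \<in> carrier (Z2_c r)"
  shows "cls r \<tau> \<in> carrier (H2_cc r) \<longleftrightarrow> symmetric \<tau>"
proof
  assume "cls r \<tau> \<in> carrier (H2_cc r)"
  then obtain \<sigma> where \<sigma>: "\<sigma> \<in> B2_cc r" "cls r \<tau> = cls r \<sigma>" by (auto simp: carrier_H2_cc)
  then have "\<sigma> \<in> carrier (Z2_c r)" by (simp add: B2_cc_def)
  then have "symmetric \<sigma>" "\<tau> \<in> cls r \<sigma>" using \<sigma> B2_cc_iff cls_eq_iff[OF r _ \<tau>] by blast+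
  then show "symmetric \<tau>" using symmetric_B2_c by (fastforce simp: cls_eq symmetric_def)
qed (use B2_cc_iff[OF \<tau>] in \<open>auto simp: carrier_H2_cc\<close>)

text \<open>The arrows of a groupoid whose objects are actions; \<open>twist l \<alpha>\<close> is
  its effect on cocycles. The case r = r' treats trivial and nontrivial actions uniformly.\<close>

definition act_iso_pair ::
    "('g::ab_group_add \<Rightarrow> 'c::ab_group_add \<Rightarrow> 'g) \<Rightarrow> ('g \<Rightarrow> 'c \<Rightarrow> 'g) \<Rightarrow> ('g \<Rightarrow> 'g) \<Rightarrow> ('c \<Rightarrow> 'c) \<Rightarrow> bool"
  where "act_iso_pair r r' l \<alpha> \<longleftrightarrow> \<alpha> \<in> auto add_grp \<and> l \<in> act_isos r (act_pow r' \<alpha>)"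

lemma act_iso_pair_iff:
  "act_iso_pair r r' l \<alpha> \<longleftrightarrow> (\<forall>x y. \<alpha> (x + y) = \<alpha> x + \<alpha> y) \<and> bij \<alpha> \<and>
     (\<forall>a b. l (a + b) = l a + l b) \<and> bij l \<and> (\<forall>a x. l (r a x) = r' (l a) (\<alpha> x))"
  by (auto simp: act_iso_pair_def act_isos_def act_pow_def auto_add_grp_iff)

lemma twist_eq: "twist l \<alpha> \<tau> x a b = \<tau> (inv_into UNIV \<alpha> x) (inv_into UNIV l a) (inv_into UNIV l b)"
  by (simp add: twist_def coc_pow_def coc_aut_def)

lemma bij_inv_simps:
  "bij f \<Longrightarrow> f (inv_into UNIV f y) = y" "bij f \<Longrightarrow> inv_into UNIV f (f x) = x"
  by (simp_all add: bij_is_surj surj_f_inv_f bij_is_inj)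

lemma additive_inv: "bij f \<Longrightarrow> (\<And>x y. f (x + y) = f x + f y) \<Longrightarrow>
    inv_into UNIV f (x + y) = inv_into UNIV f x + inv_into UNIV f y"
  by (metis bij_inv_simps)

lemma act_iso_pair_ident: "act_iso_pair r r (\<lambda>a. a) (\<lambda>x. x)"
  by (simp add: act_iso_pair_iff bij_id[unfolded id_def])

lemma twist_ident: "twist (\<lambda>a. a) (\<lambda>x. x) \<tau> = \<tau>"
  by (simp add: fun_eq_iff twist_eq bij_inv_simps(2)[OF bij_id[unfolded id_def]])

lemma act_iso_pair_comp:
  "act_iso_pair r r' l \<alpha> \<Longrightarrow> act_iso_pair r' r'' l' \<alpha>' \<Longrightarrow> act_iso_pair r r'' (l' \<circ> l) (\<alpha>' \<circ> \<alpha>)"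
  by (simp add: act_iso_pair_iff bij_comp)

lemma twist_comp:
  assumes "act_iso_pair r r' l \<alpha>" "act_iso_pair r' r'' l' \<alpha>'"
  shows "twist (l' \<circ> l) (\<alpha>' \<circ> \<alpha>) \<tau> = twist l' \<alpha>' (twist l \<alpha> \<tau>)"
  using assms by (simp add: fun_eq_iff twist_eq act_iso_pair_iff o_inv_distrib)

lemma act_iso_pair_inv:
  assumes "act_iso_pair r r' l \<alpha>"
  shows "act_iso_pair r' r (inv_into UNIV l) (inv_into UNIV \<alpha>)"
proof -
  note * = assms[unfolded act_iso_pair_iff]
  have "inv_into UNIV l (r' a x) = r (inv_into UNIV l a) (inv_into UNIV \<alpha> x)" for a x
    using * by (metis bij_inv_simps)
  then show ?thesis
    using * additive_inv[of l] additive_inv[of \<alpha>] by (simp add: act_iso_pair_iff bij_imp_bij_inv)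
qed

lemma twist_inv:
  assumes "act_iso_pair r r' l \<alpha>"
  shows "twist (inv_into UNIV l) (inv_into UNIV \<alpha>) (twist l \<alpha> \<tau>) = \<tau>"
  using assms by (simp add: fun_eq_iff twist_eq act_iso_pair_iff inv_inv_eq bij_inv_simps)

lemma twist_Z2_c:
  assumes p: "act_iso_pair r r' l \<alpha>" and \<tau>: "\<tau> \<in> carrier (Z2_c r)"
  shows "twist l \<alpha> \<tau> \<in> carrier (Z2_c r')"
proof -
  note * = act_iso_pair_inv[OF p, unfolded act_iso_pair_iff]
  have "inv_into UNIV l 0 = 0" "inv_into UNIV \<alpha> 0 = 0"
    using * by (metis add_cancel_right_left)+
  then show ?thesis
    using * Z2_c_D(5,6)[OF \<tau>] by (intro Z2_c_I) (simp_all only: twist_eq Z2_c_D(1-4)[OF \<tau>], simp_all)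
qed

lemma twist_B2_c:
  assumes p: "act_iso_pair r r' l \<alpha>" and "\<beta> \<in> B2_c r"
  shows "twist l \<alpha> \<beta> \<in> B2_c r'"
proof -
  obtain \<eta> where \<beta>: "\<beta> = dG \<eta>" and \<eta>: "\<eta> \<in> cochains1" "\<And>x y a. \<eta> (x + y) a = \<eta> x a * \<eta> y (r a x)"
    using assms(2) by (auto simp: B2_c_def)
  note * = act_iso_pair_inv[OF p, unfolded act_iso_pair_iff]
  have 0: "inv_into UNIV l 0 = 0" "inv_into UNIV \<alpha> 0 = 0"
    using * by (metis add_cancel_right_left)+
  define \<zeta> where "\<zeta> x a = \<eta> (inv_into UNIV \<alpha> x) (inv_into UNIV l a)" for x a
  have "twist l \<alpha> \<beta> = dG \<zeta>" using * by (simp add: fun_eq_iff twist_eq \<beta> dG_def \<zeta>_def)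
  moreover have "\<zeta> \<in> cochains1" using \<eta>(1) 0 by (simp add: cochains1_def \<zeta>_def)
  moreover have "\<zeta> (x + y) a = \<zeta> x a * \<zeta> y (r' a x)" for x y a using * by (simp add: \<zeta>_def \<eta>(2))
  ultimately show ?thesis by (auto simp: B2_c_def)
qed

text \<open>Twisting is multiplicative and carries \<open>B2_c r\<close> onto
  \<open>B2_c r'\<close>, with the inverse pair giving the reverse inclusion. The orbits are defined
  by images of cosets, so this turns them into statements about representatives.\<close>

lemma twist_cls:
  assumes p: "act_iso_pair r r' l \<alpha>"
  shows "twist l \<alpha> ` cls r \<tau> = cls r' (twist l \<alpha> \<tau>)"
proof
  have mult: "twist l \<alpha> (\<lambda>x a b. \<beta> x a b * \<tau> x a b) = (\<lambda>x a b. twist l \<alpha> \<beta> x a b * twist l \<alpha> \<tau> x a b)" for \<beta> \<tau>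
    by (simp add: fun_eq_iff twist_eq)
  then show "twist l \<alpha> ` cls r \<tau> \<subseteq> cls r' (twist l \<alpha> \<tau>)"
    using twist_B2_c[OF p] by (auto simp: cls_eq)
  show "cls r' (twist l \<alpha> \<tau>) \<subseteq> twist l \<alpha> ` cls r \<tau>"
  proof
    fix \<sigma> assume "\<sigma> \<in> cls r' (twist l \<alpha> \<tau>)"
    then obtain \<beta> where \<beta>: "\<beta> \<in> B2_c r'" "\<sigma> = (\<lambda>x a b. \<beta> x a b * twist l \<alpha> \<tau> x a b)"
      by (auto simp: cls_eq)
    define \<gamma> where "\<gamma> = twist (inv_into UNIV l) (inv_into UNIV \<alpha>) \<beta>"
    have "\<gamma> \<in> B2_c r" unfolding \<gamma>_def by (rule twist_B2_c[OF act_iso_pair_inv[OF p] \<beta>(1)])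
    moreover have "twist l \<alpha> \<gamma> = \<beta>"
      using p by (simp add: \<gamma>_def fun_eq_iff twist_eq act_iso_pair_iff inv_inv_eq bij_inv_simps)
    then have "\<sigma> = twist l \<alpha> (\<lambda>x a b. \<gamma> x a b * \<tau> x a b)" by (simp add: mult \<beta>(2))
    ultimately show "\<sigma> \<in> twist l \<alpha> ` cls r \<tau>" by (auto simp: cls_eq)
  qed
qed

section \<open>Hopf algebra isomorphisms and classes\<close>

lemma hopf_isomorphic_of_cls:
  assumes "is_action r'" "\<tau> \<in> carrier (Z2_c r)" "\<tau>' \<in> carrier (Z2_c r')"
    and p: "act_iso_pair r r' l \<alpha>" and cls: "cls r' \<tau>' = cls r' (twist l \<alpha> \<tau>)"
  shows "hopf_isomorphic (H_alg \<tau> r) (H_alg \<tau>' r')"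
proof -
  have "\<tau>' \<in> cls r' (twist l \<alpha> \<tau>)" using cls cls_self[OF assms(1,3)] by blast
  then obtain \<eta> where \<eta>: "\<eta> \<in> cochains1" "\<And>x y a. \<eta> (x + y) a = \<eta> x a * \<eta> y (r' a x)"
    and "\<tau>' = (\<lambda>x a b. dG \<eta> x a b * twist l \<alpha> \<tau> x a b)"
    by (auto simp: cls_eq B2_c_def)
  then show ?thesis
    using p hopf_iso_of_cochain[of \<alpha> l r r' \<eta> \<tau>' \<tau>] unfolding hopf_isomorphic_def act_iso_pair_def by blast
qed

text \<open>The cochain extracted from an isomorphism satisfies the condition in
  \<open>B2_c r'\<close>, not just normalization; hence the two cocycles agree as classes in the
  finer group \<open>H2_c r'\<close>.\<close>

lemma hopf_isomorphic_iff:
  fixes r r' :: "'g::{finite, ab_group_add} \<Rightarrow> 'c::{finite, ab_group_add} \<Rightarrow> 'g"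
    and \<tau> \<tau>' :: "'c \<Rightarrow> 'g \<Rightarrow> 'g \<Rightarrow> 'k::field"
  assumes "prime CARD('c)" "is_action r" "is_action r'" "\<tau> \<in> carrier (Z2_c r)" "\<tau>' \<in> carrier (Z2_c r')"
    and "\<not> symmetric \<tau>'"
  shows "hopf_isomorphic (H_alg \<tau> r) (H_alg \<tau>' r') \<longleftrightarrow>
    (\<exists>\<alpha> l. act_iso_pair r r' l \<alpha> \<and> cls r' \<tau>' = cls r' (twist l \<alpha> \<tau>))"
proof
  assume "hopf_isomorphic (H_alg \<tau> r) (H_alg \<tau>' r')"
  then obtain f where f: "hopf_iso (H_alg \<tau> r) (H_alg \<tau>' r') f" by (auto simp: hopf_isomorphic_def)
  have cd: "cocycle_data \<tau> r" "cocycle_data \<tau>' r'" using assms by (auto simp: cocycle_data_def)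
  obtain \<alpha> l \<eta> where p: "\<alpha> \<in> auto add_grp" "l \<in> act_isos r (act_pow r' \<alpha>)"
    and \<eta>: "\<eta> \<in> cochains1" "\<And>x y a. \<eta> (x + y) a = \<eta> x a * \<eta> y (r' a x)"
    and \<tau>': "\<And>x a b. \<tau>' x a b = dG \<eta> x a b * twist l \<alpha> \<tau> x a b"
    by (rule cochain_of_hopf_iso[OF cd f not_symmetric_pointwise[OF assms(1,3,5,6)]], assumption) (rule that)
  have p: "act_iso_pair r r' l \<alpha>" using p by (simp add: act_iso_pair_def)
  have "dG \<eta> \<in> B2_c r'" using \<eta> by (auto simp: B2_c_def)
  then have "\<tau>' \<in> cls r' (twist l \<alpha> \<tau>)" unfolding cls_eq using \<tau>' by blast
  then have "cls r' \<tau>' = cls r' (twist l \<alpha> \<tau>)"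
    using cls_eq_iff[OF assms(3) twist_Z2_c[OF p assms(4)] assms(5)] by blast
  then show "\<exists>\<alpha> l. act_iso_pair r r' l \<alpha> \<and> cls r' \<tau>' = cls r' (twist l \<alpha> \<tau>)" using p by blast
qed (use hopf_isomorphic_of_cls assms in blast)

section \<open>Orbits\<close>

text \<open>A common description of the orbits in both cases of \<open>GG_orbits\<close>,
  independent of the chosen \<open>lam\<close>.\<close>

definition twist_orbit ::
    "('g::ab_group_add \<Rightarrow> 'c::ab_group_add \<Rightarrow> 'g) \<Rightarrow> ('c \<Rightarrow> 'g \<Rightarrow> 'g \<Rightarrow> 'k::field)
      \<Rightarrow> ('c \<Rightarrow> 'g \<Rightarrow> 'g \<Rightarrow> 'k) set set"
  where "twist_orbit r \<tau> = {cls r (twist l \<alpha> \<tau>) | l \<alpha>. act_iso_pair r r l \<alpha>}"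

lemma group_AutoGroup_add_grp: "group (AutoGroup (add_grp :: 'a::ab_group_add monoid))"
  by (rule group.AutoGroup[OF group_add_grp])

lemma AutoGroup_add_grp_simps:
  "carrier (AutoGroup add_grp) = auto (add_grp :: 'a::ab_group_add monoid)"
  "\<one>\<^bsub>AutoGroup add_grp\<^esub> = (\<lambda>a :: 'a. a)"
  "f \<in> auto add_grp \<Longrightarrow> g \<in> auto add_grp \<Longrightarrow> f \<otimes>\<^bsub>AutoGroup add_grp\<^esub> g = f \<circ> (g :: 'a \<Rightarrow> 'a)"
  by (auto simp: AutoGroup_def BijGroup_def add_grp_def auto_def compose_def restrict_def comp_def)

lemma inv_AutoGroup_add_grp:
  assumes "f \<in> auto (add_grp :: 'a::ab_group_add monoid)"
  shows "inv\<^bsub>AutoGroup add_grp\<^esub> f = inv_into UNIV f"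
proof -
  interpret group "AutoGroup (add_grp :: 'a monoid)" by (rule group_AutoGroup_add_grp)
  have f: "bij f" "\<And>x y. f (x + y) = f x + f y" using assms by (auto simp: auto_add_grp_iff)
  have g: "inv_into UNIV f \<in> auto add_grp"
    using additive_inv[OF f] by (simp add: auto_add_grp_iff bij_imp_bij_inv f(1))
  show ?thesis
    by (rule inv_equality)
      (use assms g in \<open>auto simp: AutoGroup_add_grp_simps fun_eq_iff bij_inv_simps f(1)\<close>)
qed

lemma act_iso_pair_D: "act_iso_pair r r' l \<alpha> \<Longrightarrow> l \<in> auto add_grp \<and> \<alpha> \<in> auto add_grp"
  by (simp add: act_iso_pair_iff auto_add_grp_iff)

text \<open>The second components of pairs compose along with the first, which gives closure.
  Conversely, an l belonging to \<alpha> differs from \<open>lam \<alpha>\<close> by a factor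
  belonging to the identity of 'c, that is, by an element of \<open>act_isos r r\<close>.\<close>

lemma carrier_GG:
  fixes r :: "'a::ab_group_add \<Rightarrow> 'c::ab_group_add \<Rightarrow> 'a"
  assumes lam: "\<And>\<alpha>. \<alpha> \<in> stab_C r \<Longrightarrow> lam \<alpha> \<in> act_isos r (act_pow r \<alpha>)"
  shows "carrier (GG r lam) = {l. \<exists>\<alpha>. act_iso_pair r r l \<alpha>}"
proof -
  let ?A = "AutoGroup (add_grp :: 'a monoid)"
  let ?K = "{l. \<exists>\<alpha>. act_iso_pair r r l \<alpha>}"
  let ?S = "act_isos r r \<union> lam ` stab_C r"
  interpret group ?A by (rule group_AutoGroup_add_grp)
  have 1: "l \<in> act_isos r r \<longleftrightarrow> act_iso_pair r r l (\<lambda>x. x)" for l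
    by (auto simp: act_iso_pair_iff act_isos_def auto_add_grp_iff bij_id[unfolded id_def])
  have 2: "act_iso_pair r r (lam \<alpha>) \<alpha>" if "\<alpha> \<in> stab_C r" for \<alpha>
    using lam[OF that] that by (auto simp: act_iso_pair_def stab_C_def)
  have "l \<in> ?K" if "l \<in> generate ?A ?S" for l
    using that
  proof induction
    case one
    show ?case using act_iso_pair_ident[of r] by (auto simp: AutoGroup_add_grp_simps)
  next
    case (incl l)
    then show ?case using 1 2 by auto
  next
    case (inv l)
    then obtain \<alpha> where "act_iso_pair r r l \<alpha>" using 1 2 by auto
    then show ?case using act_iso_pair_inv[of r r l \<alpha>] act_iso_pair_D[of r r l \<alpha>]
      by (auto simp: inv_AutoGroup_add_grp)
  next
    case (eng l l')
    then obtain \<alpha> \<alpha>' where "act_iso_pair r r l \<alpha>" "act_iso_pair r r l' \<alpha>'" by auto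
    then have "act_iso_pair r r (l \<circ> l') (\<alpha> \<circ> \<alpha>')" "l \<otimes>\<^bsub>?A\<^esub> l' = l \<circ> l'"
      using act_iso_pair_comp[of r r l' \<alpha>' r l \<alpha>] act_iso_pair_D[of r r l \<alpha>] act_iso_pair_D[of r r l' \<alpha>']
      by (simp_all only: AutoGroup_add_grp_simps)
    then show ?case unfolding mem_Collect_eq by metis
  qed
  moreover have "l \<in> generate ?A ?S" if "act_iso_pair r r l \<alpha>" for l \<alpha>
  proof -
    have \<alpha>: "\<alpha> \<in> stab_C r" using that by (auto simp: act_iso_pair_def stab_C_def)
    define m where "m = lam \<alpha>"
    have m: "act_iso_pair r r m \<alpha>" unfolding m_def by (rule 2[OF \<alpha>])
    have \<alpha>': "\<alpha> \<circ> inv_into UNIV \<alpha> = (\<lambda>x. x)"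
      using that by (auto simp: act_iso_pair_iff bij_inv_simps)
    define n where "n = l \<circ> inv_into UNIV m"
    have n: "n \<in> act_isos r r"
      using act_iso_pair_comp[OF act_iso_pair_inv[OF m] that] by (simp add: 1 \<alpha>' n_def)
    have "l = n \<circ> m" using m by (auto simp: n_def act_iso_pair_iff bij_inv_simps)
    also have "\<dots> = n \<otimes>\<^bsub>?A\<^esub> m"
      using n act_iso_pair_D[OF m] by (simp add: AutoGroup_add_grp_simps act_isos_def)
    also have "\<dots> \<in> generate ?A ?S"
      by (rule generate.eng[OF generate.incl generate.incl]) (use n \<alpha> in \<open>auto simp: m_def\<close>)
    finally show ?thesis .
  qed
  ultimately show ?thesis by (auto simp: GG_def)
qed

text \<open>For the trivial action every two automorphisms form a pair. Otherwise \<open>l\<close>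
  determines \<alpha>: two candidates give the same action on all points \<open>l b\<close>, which
  exhaust 'g, and the action is faithful.\<close>

lemma GG_orbits_eq:
  fixes r :: "'g::ab_group_add \<Rightarrow> 'c::{finite, ab_group_add} \<Rightarrow> 'g"
  assumes p: "prime CARD('c)" and r: "is_action r"
    and lam: "\<not> trivial_action r \<Longrightarrow> \<forall>\<alpha>\<in>stab_C r. lam \<alpha> \<in> act_isos r (act_pow r \<alpha>)"
  shows "GG_orbits r lam = twist_orbit r ` carrier (Z2_c r)"
proof (cases "trivial_action r")
  case True
  then have act: "act_iso_pair r r l \<alpha> \<longleftrightarrow> l \<in> auto add_grp \<and> \<alpha> \<in> auto add_grp" for l \<alpha>
    by (auto simp: act_iso_pair_iff trivial_action_def auto_add_grp_iff)
  have "orbit (AutoGroup add_grp \<times>\<times> AutoGroup add_grp) (\<lambda>(l, \<alpha>) T. twist l \<alpha> ` T) (cls r \<tau>) = twist_orbit r \<tau>" for \<tau>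
  proof -
    have "orbit (AutoGroup add_grp \<times>\<times> AutoGroup add_grp) (\<lambda>(l, \<alpha>) T. twist l \<alpha> ` T) (cls r \<tau>) =
      {twist l \<alpha> ` cls r \<tau> | l \<alpha>. act_iso_pair r r l \<alpha>}"
      unfolding orbit_def act by (auto simp: AutoGroup_add_grp_simps)
    also have "\<dots> = twist_orbit r \<tau>"
      unfolding twist_orbit_def by (rule Collect_cong, rule ex_cong1, rule ex_cong1) (simp add: twist_cls cong: rev_conj_cong)
    finally show ?thesis .
  qed
  then show ?thesis using True by (auto simp: GG_orbits_def orbits_def carrier_H2_c)
next
  case False
  have the: "(THE \<alpha>. \<alpha> \<in> stab_C r \<and> l \<in> act_isos r (act_pow r \<alpha>)) = \<alpha>" if l: "act_iso_pair r r l \<alpha>" for l \<alpha>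
  proof (rule the_equality)
    show "\<alpha> \<in> stab_C r \<and> l \<in> act_isos r (act_pow r \<alpha>)" using l by (auto simp: act_iso_pair_def stab_C_def)
    fix \<beta> assume "\<beta> \<in> stab_C r \<and> l \<in> act_isos r (act_pow r \<beta>)"
    then have \<beta>: "act_iso_pair r r l \<beta>" by (auto simp: act_iso_pair_def stab_C_def)
    show "\<beta> = \<alpha>"
    proof
      fix x
      have "r a (\<beta> x) = r a (\<alpha> x)" for a
      proof -
        obtain b where "a = l b" using l by (metis act_iso_pair_iff bij_pointE)
        moreover have "r (l b) (\<beta> x) = l (r b x)" "r (l b) (\<alpha> x) = l (r b x)"
          using l \<beta> by (simp_all add: act_iso_pair_iff)
        ultimately show ?thesis by simp
      qed
      then show "\<beta> x = \<alpha> x" using nontrivial_action_faithful[OF p r False] by blast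
    qed
  qed
  have "orbit (GG r lam) (GG_act r) (cls r \<tau>) = twist_orbit r \<tau>" for \<tau>
  proof -
    have GA: "GG_act r l (cls r \<tau>) = cls r (twist l \<alpha> \<tau>)" if "act_iso_pair r r l \<alpha>" for l \<alpha>
      using that by (simp add: GG_act_def the twist_cls)
    have "carrier (GG r lam) = {l. \<exists>\<alpha>. act_iso_pair r r l \<alpha>}" using carrier_GG lam False by blast
    then have "orbit (GG r lam) (GG_act r) (cls r \<tau>) = {GG_act r l (cls r \<tau>) | l \<alpha>. act_iso_pair r r l \<alpha>}"
      by (auto simp: orbit_def)
    also have "\<dots> = twist_orbit r \<tau>"
      unfolding twist_orbit_def by (rule Collect_cong, rule ex_cong1, rule ex_cong1) (simp add: GA cong: rev_conj_cong)
    finally show ?thesis .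
  qed
  then show ?thesis using False by (auto simp: GG_orbits_def orbits_def carrier_H2_c)
qed

lemma cls_twist_cong:
  assumes "act_iso_pair r r' l \<alpha>" "cls r \<tau> = cls r \<sigma>"
  shows "cls r' (twist l \<alpha> \<tau>) = cls r' (twist l \<alpha> \<sigma>)"
  using twist_cls[OF assms(1), of \<tau>] twist_cls[OF assms(1), of \<sigma>] assms(2) by simp

lemma twist_orbit_subset:
  assumes p: "act_iso_pair r r l \<alpha>" and c: "cls r \<sigma> = cls r (twist l \<alpha> \<tau>)"
  shows "twist_orbit r \<sigma> \<subseteq> twist_orbit r \<tau>"
proof
  fix T assume "T \<in> twist_orbit r \<sigma>"
  then obtain l' \<alpha>' where q: "act_iso_pair r r l' \<alpha>'" and T: "T = cls r (twist l' \<alpha>' \<sigma>)"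
    by (auto simp: twist_orbit_def)
  have "T = cls r (twist (l' \<circ> l) (\<alpha>' \<circ> \<alpha>) \<tau>)"
    unfolding T twist_comp[OF p q] by (rule cls_twist_cong[OF q c])
  then show "T \<in> twist_orbit r \<tau>" using act_iso_pair_comp[OF p q] by (auto simp: twist_orbit_def)
qed

text \<open>Pairs can be inverted, so the inclusion of orbits obtained from one pair holds in both
  directions.\<close>

lemma twist_orbit_eq_iff:
  "twist_orbit r \<tau> = twist_orbit r \<sigma> \<longleftrightarrow>
    (\<exists>\<alpha> l. act_iso_pair r r l \<alpha> \<and> cls r \<sigma> = cls r (twist l \<alpha> \<tau>))"
proof
  assume "twist_orbit r \<tau> = twist_orbit r \<sigma>"
  moreover have "cls r \<sigma> \<in> twist_orbit r \<sigma>"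
    unfolding twist_orbit_def using act_iso_pair_ident[of r] twist_ident[of \<sigma>] by force
  ultimately have "cls r \<sigma> \<in> twist_orbit r \<tau>" by simp
  then show "\<exists>\<alpha> l. act_iso_pair r r l \<alpha> \<and> cls r \<sigma> = cls r (twist l \<alpha> \<tau>)"
    by (auto simp: twist_orbit_def)
next
  assume "\<exists>\<alpha> l. act_iso_pair r r l \<alpha> \<and> cls r \<sigma> = cls r (twist l \<alpha> \<tau>)"
  then obtain \<alpha> l where p: "act_iso_pair r r l \<alpha>" and c: "cls r \<sigma> = cls r (twist l \<alpha> \<tau>)" by blast
  have "cls r (twist (inv_into UNIV l) (inv_into UNIV \<alpha>) \<sigma>) = cls r \<tau>"
    using cls_twist_cong[OF act_iso_pair_inv[OF p] c] by (simp add: twist_inv[OF p])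
  then show "twist_orbit r \<tau> = twist_orbit r \<sigma>"
    using twist_orbit_subset[OF p c] twist_orbit_subset[OF act_iso_pair_inv[OF p]] by blast
qed

text \<open>Twisting preserves symmetry, so the base point decides for its whole orbit.\<close>

lemma twist_orbit_subset_H2_cc_iff:
  fixes \<tau> :: "'c::ab_group_add \<Rightarrow> 'g::{finite, ab_group_add} \<Rightarrow> 'g \<Rightarrow> 'k::alg_closed_field"
  assumes r: "is_action r" and \<tau>: "\<tau> \<in> carrier (Z2_c r)"
  shows "twist_orbit r \<tau> \<subseteq> carrier (H2_cc r) \<longleftrightarrow> symmetric \<tau>"
proof
  assume *: "twist_orbit r \<tau> \<subseteq> carrier (H2_cc r)"
  have "cls r \<tau> \<in> twist_orbit r \<tau>"
    unfolding twist_orbit_def using act_iso_pair_ident[of r] twist_ident[of \<tau>] by force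
  then show "symmetric \<tau>" using * cls_in_H2_cc_iff[OF r \<tau>] by blast
next
  assume "symmetric \<tau>"
  then have "symmetric (twist l \<alpha> \<tau>)" for l \<alpha> by (simp add: symmetric_def twist_eq)
  then show "twist_orbit r \<tau> \<subseteq> carrier (H2_cc r)"
    using cls_in_H2_cc_iff[OF r twist_Z2_c[OF _ \<tau>]] by (auto simp: twist_orbit_def)
qed

section \<open>Classes of extensions\<close>

lemma H_ext_in_class:
  assumes "is_action r" "\<tau> \<in> carrier (Z2_c r)"
  shows "H_ext \<tau> r \<in> ext_equiv `` {H_ext \<tau> r}"
  using cocycle_data.H_extension[of \<tau> r] assms equiv_class_self[OF equiv_ext_equiv, of "H_ext \<tau> r"]
  by (simp add: cocycle_data_def)

lemma ext_equiv_hopf_isomorphic: "(E, E') \<in> ext_equiv \<Longrightarrow> hopf_isomorphic (fst E) (fst E')"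
  by (auto simp: ext_equiv_def hopf_isomorphic_def)

lemma fst_H_ext: "fst (H_ext \<tau> r) = H_alg \<tau> r"
  by (simp add: H_ext_def)

lemma class_hopf_iso_H_ext_iff:
  assumes "is_action r" "\<tau> \<in> carrier (Z2_c r)" "is_action r'" "\<tau>' \<in> carrier (Z2_c r')"
  shows "(ext_equiv `` {H_ext \<tau> r}, ext_equiv `` {H_ext \<tau>' r'}) \<in> class_hopf_iso \<longleftrightarrow>
    hopf_isomorphic (H_alg \<tau> r) (H_alg \<tau>' r')"
proof
  assume "(ext_equiv `` {H_ext \<tau> r}, ext_equiv `` {H_ext \<tau>' r'}) \<in> class_hopf_iso"
  then obtain E E' where E: "(H_ext \<tau> r, E) \<in> ext_equiv" "(H_ext \<tau>' r', E') \<in> ext_equiv"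
    "hopf_isomorphic (fst E) (fst E')" by (auto simp: class_hopf_iso_def)
  have "hopf_isomorphic (fst (H_ext \<tau> r)) (fst E')"
    by (rule hopf_isomorphic_trans[OF ext_equiv_hopf_isomorphic[OF E(1)] E(3)])
  also have "hopf_isomorphic (fst E') (fst (H_ext \<tau>' r'))"
    by (rule hopf_isomorphic_sym[OF ext_equiv_hopf_isomorphic[OF E(2)]])
  finally (hopf_isomorphic_trans) show "hopf_isomorphic (H_alg \<tau> r) (H_alg \<tau>' r')"
    by (simp only: fst_H_ext)
next
  assume "hopf_isomorphic (H_alg \<tau> r) (H_alg \<tau>' r')"
  then have iso: "hopf_isomorphic (fst (H_ext \<tau> r)) (fst (H_ext \<tau>' r'))" by (simp only: fst_H_ext)
  show "(ext_equiv `` {H_ext \<tau> r}, ext_equiv `` {H_ext \<tau>' r'}) \<in> class_hopf_iso"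
    unfolding class_hopf_iso_def mem_Collect_eq prod.case
    by (rule bexI[where x = "H_ext \<tau> r"], rule bexI[where x = "H_ext \<tau>' r'"])
      (rule iso H_ext_in_class[OF assms(1,2)] H_ext_in_class[OF assms(3,4)])+
qed

text \<open>Equivalent extensions have isomorphic Hopf algebras and cocommutativity is invariant, so
  the representative \<open>H_ext \<tau> r'\<close> decides for its class.\<close>

lemma noncocomm_Ext_eq:
  "noncocomm_Ext r = {ext_equiv `` {H_ext \<tau> r'} | \<tau> r'.
    r' \<in> act_class r \<and> \<tau> \<in> carrier (Z2_c r') \<and> \<not> symmetric \<tau>}"
proof -
  have key: "(\<forall>E\<in>ext_equiv `` {H_ext \<tau> r'}. \<not> cocommutative (fst E)) \<longleftrightarrow> \<not> symmetric \<tau>"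
    if "is_action r'" "\<tau> \<in> carrier (Z2_c r')" for \<tau> r'
  proof
    assume "\<forall>E\<in>ext_equiv `` {H_ext \<tau> r'}. \<not> cocommutative (fst E)"
    then have "\<not> cocommutative (fst (H_ext \<tau> r'))" using H_ext_in_class[OF that] by blast
    then show "\<not> symmetric \<tau>" by (simp add: fst_H_ext cocommutative_H_iff symmetric_def)
  next
    assume *: "\<not> symmetric \<tau>"
    show "\<forall>E\<in>ext_equiv `` {H_ext \<tau> r'}. \<not> cocommutative (fst E)"
    proof (intro ballI notI)
      fix E assume "E \<in> ext_equiv `` {H_ext \<tau> r'}" and E: "cocommutative (fst E)"
      then have "hopf_isomorphic (fst (H_ext \<tau> r')) (fst E)"
        by (intro ext_equiv_hopf_isomorphic) simp
      from cocommutative_hopf_isomorphic[OF hopf_isomorphic_sym[OF this] E]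
      have "cocommutative (H_alg \<tau> r')" by (simp only: fst_H_ext)
      then show False using * by (simp add: cocommutative_H_iff symmetric_def)
    qed
  qed
  have act: "is_action r'" if "r' \<in> act_class r" for r' using that by (simp add: act_class_def)
  show ?thesis
  proof (intro equalityI subsetI)
    fix X assume "X \<in> noncocomm_Ext r"
    then obtain \<tau> r' where X: "X = ext_equiv `` {H_ext \<tau> r'}" "r' \<in> act_class r" "\<tau> \<in> carrier (Z2_c r')"
      and "\<forall>E\<in>X. \<not> cocommutative (fst E)"
      unfolding noncocomm_Ext_def Ext_def by blast
    then have "\<not> symmetric \<tau>" using key[OF act[OF X(2)] X(3)] by simp
    then show "X \<in> {ext_equiv `` {H_ext \<tau> r'} | \<tau> r'.
        r' \<in> act_class r \<and> \<tau> \<in> carrier (Z2_c r') \<and> \<not> symmetric \<tau>}" using X by blast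
  next
    fix X assume "X \<in> {ext_equiv `` {H_ext \<tau> r'} | \<tau> r'.
        r' \<in> act_class r \<and> \<tau> \<in> carrier (Z2_c r') \<and> \<not> symmetric \<tau>}"
    then obtain \<tau> r' where X: "X = ext_equiv `` {H_ext \<tau> r'}" "r' \<in> act_class r" "\<tau> \<in> carrier (Z2_c r')"
      and "\<not> symmetric \<tau>" by blast
    then have "\<forall>E\<in>X. \<not> cocommutative (fst E)" using key[OF act[OF X(2)] X(3)] by simp
    then show "X \<in> noncocomm_Ext r" unfolding noncocomm_Ext_def Ext_def using X by blast
  qed
qed

text \<open>\<open>class_hopf_iso\<close> asks for some pair of representatives, and those of two
  related pairs need not match in the middle class. Transitivity comes from moving every isomorphism
  to the representatives \<open>H_ext\<close>.\<close>

lemma equiv_class_hopf_iso: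
  "equiv (noncocomm_Ext r) (class_hopf_iso \<inter> noncocomm_Ext r \<times> noncocomm_Ext r)"
proof (rule equivI)
  show "refl_on (noncocomm_Ext r) (class_hopf_iso \<inter> noncocomm_Ext r \<times> noncocomm_Ext r)"
  proof (rule refl_onI)
    fix X assume X: "X \<in> noncocomm_Ext r"
    then have "(X, X) \<in> class_hopf_iso"
      by (auto simp: noncocomm_Ext_eq act_class_def class_hopf_iso_H_ext_iff hopf_isomorphic_refl)
    then show "(X, X) \<in> class_hopf_iso \<inter> noncocomm_Ext r \<times> noncocomm_Ext r" using X by blast
  qed
  show "sym (class_hopf_iso \<inter> noncocomm_Ext r \<times> noncocomm_Ext r)"
  proof (rule symI)
    fix X Y assume *: "(X, Y) \<in> class_hopf_iso \<inter> noncocomm_Ext r \<times> noncocomm_Ext r"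
    then have "(Y, X) \<in> class_hopf_iso" unfolding class_hopf_iso_def using hopf_isomorphic_sym by fast
    then show "(Y, X) \<in> class_hopf_iso \<inter> noncocomm_Ext r \<times> noncocomm_Ext r" using * by blast
  qed
  show "trans (class_hopf_iso \<inter> noncocomm_Ext r \<times> noncocomm_Ext r)"
  proof (rule transI)
    fix X Y Z assume *: "(X, Y) \<in> class_hopf_iso \<inter> noncocomm_Ext r \<times> noncocomm_Ext r"
      "(Y, Z) \<in> class_hopf_iso \<inter> noncocomm_Ext r \<times> noncocomm_Ext r"
    obtain \<tau>1 r1 \<tau>2 r2 \<tau>3 r3 where
      X: "X = ext_equiv `` {H_ext \<tau>1 r1}" "is_action r1" "\<tau>1 \<in> carrier (Z2_c r1)" and
      Y: "Y = ext_equiv `` {H_ext \<tau>2 r2}" "is_action r2" "\<tau>2 \<in> carrier (Z2_c r2)" and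
      Z: "Z = ext_equiv `` {H_ext \<tau>3 r3}" "is_action r3" "\<tau>3 \<in> carrier (Z2_c r3)"
      using * unfolding noncocomm_Ext_eq act_class_def by blast
    have "(X, Z) \<in> class_hopf_iso"
      using * X Y Z by (auto simp: class_hopf_iso_H_ext_iff intro: hopf_isomorphic_trans)
    then show "(X, Z) \<in> class_hopf_iso \<inter> noncocomm_Ext r \<times> noncocomm_Ext r" using * by blast
  qed
qed auto

text \<open>Equal fibres make the assignment of \<open>\<psi> s\<close> to \<open>\<phi> s\<close>
  well defined and injective.\<close>

lemma bij_betw_of_surjections:
  assumes "\<phi> ` S = A" "\<psi> ` S = B" "\<And>s t. s \<in> S \<Longrightarrow> t \<in> S \<Longrightarrow> \<phi> s = \<phi> t \<longleftrightarrow> \<psi> s = \<psi> t"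
  shows "\<exists>f. bij_betw f A B"
proof -
  define f where "f a = \<psi> (inv_into S \<phi> a)" for a
  have f: "f (\<phi> s) = \<psi> s" if "s \<in> S" for s
    using assms(3)[OF inv_into_into[OF imageI[OF that, of \<phi>]] that] f_inv_into_f[OF imageI[OF that, of \<phi>]]
    by (simp add: f_def)
  have "f ` A = B" unfolding assms(1,2)[symmetric] image_image by (rule image_cong[OF refl f])
  moreover have "inj_on f A"
  proof (rule inj_onI)
    fix a b assume "a \<in> A" "b \<in> A" and eq: "f a = f b"
    then obtain s t where "s \<in> S" "a = \<phi> s" "t \<in> S" "b = \<phi> t" using assms(1) by blast
    then show "a = b" using eq f assms(3)[of s t] by simp
  qed
  ultimately show ?thesis unfolding bij_betw_def by blast
qed

theorem theorem4p12:
  fixes p :: nat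
  assumes "prime p"
    and "CARD('c::{finite, ab_group_add}) = p"
    and "\<exists>n. CARD('g::{finite, ab_group_add}) = p ^ n"
  shows
    "(\<forall>(r :: 'g \<Rightarrow> 'c \<Rightarrow> 'g) r' (\<tau> :: 'c \<Rightarrow> 'g \<Rightarrow> 'g \<Rightarrow> 'k::{alg_closed_field, field_char_0}) \<tau>'.
        is_action r \<longrightarrow> is_action r' \<longrightarrow>
        \<tau> \<in> carrier (Z2_c r) \<longrightarrow> \<tau>' \<in> carrier (Z2_c r') \<longrightarrow>
        \<not> cocommutative (H_alg \<tau> r) \<longrightarrow> \<not> cocommutative (H_alg \<tau>' r') \<longrightarrow>
        (hopf_isomorphic (H_alg \<tau> r) (H_alg \<tau>' r') \<longleftrightarrow>
          (\<exists>\<alpha>\<in>auto add_grp. \<exists>l\<in>act_isos r (act_pow r' \<alpha>).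
             cls r' \<tau>' = cls r' (twist l \<alpha> \<tau>)))) \<and>
     (\<forall>(r :: 'g \<Rightarrow> 'c \<Rightarrow> 'g) lam.
        is_action r \<longrightarrow>
        (\<not> trivial_action r \<longrightarrow> (\<forall>\<alpha>\<in>stab_C r. lam \<alpha> \<in> act_isos r (act_pow r \<alpha>))) \<longrightarrow>
        (\<exists>f. bij_betw f
          {X \<in> GG_orbits r lam. \<not> X \<subseteq> carrier (H2_cc r :: ('c \<Rightarrow> 'g \<Rightarrow> 'g \<Rightarrow> 'k) set monoid)}
          (noncocomm_iso_classes r :: ('k, 'c, 'g, 'c \<times> 'g) ext set set set)))"
proof (intro conjI allI impI)
  have p: "prime CARD('c)" using assms(1,2) by simp
  {
    fix r r' :: "'g \<Rightarrow> 'c \<Rightarrow> 'g" and \<tau> \<tau>' :: "'c \<Rightarrow> 'g \<Rightarrow> 'g \<Rightarrow> 'k"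
    assume a: "is_action r" "is_action r'" "\<tau> \<in> carrier (Z2_c r)" "\<tau>' \<in> carrier (Z2_c r')"
      and "\<not> cocommutative (H_alg \<tau>' r')"
    then have "\<not> symmetric \<tau>'" by (simp add: cocommutative_H_iff symmetric_def)
    from hopf_isomorphic_iff[OF p a this]
    show "hopf_isomorphic (H_alg \<tau> r) (H_alg \<tau>' r') \<longleftrightarrow>
          (\<exists>\<alpha>\<in>auto add_grp. \<exists>l\<in>act_isos r (act_pow r' \<alpha>). cls r' \<tau>' = cls r' (twist l \<alpha> \<tau>))"
      unfolding act_iso_pair_def by blast
  next
    fix r :: "'g \<Rightarrow> 'c \<Rightarrow> 'g" and lam
    assume r: "is_action r"
      and lam: "\<not> trivial_action r \<longrightarrow> (\<forall>\<alpha>\<in>stab_C r. lam \<alpha> \<in> act_isos r (act_pow r \<alpha>))"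
    define S where "S = {\<tau> :: 'c \<Rightarrow> 'g \<Rightarrow> 'g \<Rightarrow> 'k. \<tau> \<in> carrier (Z2_c r) \<and> \<not> symmetric \<tau>}"
    define R where "R = (class_hopf_iso :: (('k, 'c, 'g, 'c \<times> 'g) ext set \<times> _) set) \<inter>
      noncocomm_Ext r \<times> noncocomm_Ext r"
    define \<E> where "\<E> \<tau> = ext_equiv `` {H_ext \<tau> r}" for \<tau> :: "'c \<Rightarrow> 'g \<Rightarrow> 'g \<Rightarrow> 'k"
    have R: "equiv (noncocomm_Ext r) R" unfolding R_def by (rule equiv_class_hopf_iso)
    have "r \<in> act_class r"
      using r act_iso_pair_ident[of r] by (auto simp: act_class_def act_iso_pair_def)
    then have \<E>: "\<E> \<tau> \<in> noncocomm_Ext r" if "\<tau> \<in> S" for \<tau>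
      using that unfolding S_def \<E>_def noncocomm_Ext_eq by blast
    show "\<exists>f. bij_betw f {X \<in> GG_orbits r lam. \<not> X \<subseteq> carrier (H2_cc r :: ('c \<Rightarrow> 'g \<Rightarrow> 'g \<Rightarrow> 'k) set monoid)}
          (noncocomm_iso_classes r :: ('k, 'c, 'g, 'c \<times> 'g) ext set set set)"
    proof (rule bij_betw_of_surjections[where \<phi> = "twist_orbit r" and \<psi> = "\<lambda>\<tau>. R `` {\<E> \<tau>}" and S = S])
      have "GG_orbits r lam = twist_orbit r ` carrier (Z2_c r)"
        by (rule GG_orbits_eq[OF p r]) (use lam in blast)
      then show "twist_orbit r ` S = {X \<in> GG_orbits r lam. \<not> X \<subseteq> carrier (H2_cc r)}"
        using twist_orbit_subset_H2_cc_iff[OF r] unfolding S_def by blast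
      show "(\<lambda>\<tau>. R `` {\<E> \<tau>}) ` S = noncocomm_iso_classes r"
      proof
        show "(\<lambda>\<tau>. R `` {\<E> \<tau>}) ` S \<subseteq> noncocomm_iso_classes r"
          using \<E> unfolding noncocomm_iso_classes_def R_def[symmetric] by (auto intro: quotientI)
        show "noncocomm_iso_classes r \<subseteq> (\<lambda>\<tau>. R `` {\<E> \<tau>}) ` S"
        proof
          fix C assume "C \<in> (noncocomm_iso_classes r :: ('k, 'c, 'g, 'c \<times> 'g) ext set set set)"
          then obtain X where C: "C = R `` {X}" and X: "X \<in> noncocomm_Ext r"
            unfolding noncocomm_iso_classes_def R_def[symmetric] by (auto elim: quotientE)
          then obtain \<tau> r' where XE: "X = ext_equiv `` {H_ext \<tau> r'}" and r': "r' \<in> act_class r"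
            and \<tau>: "\<tau> \<in> carrier (Z2_c r')" "\<not> symmetric \<tau>"
            by (auto simp: noncocomm_Ext_eq)
          then obtain l \<alpha> where l: "act_iso_pair r' r l \<alpha>" and act: "is_action r'"
            by (auto simp: act_class_def act_iso_pair_def)
          \<comment> \<open>Membership of r' in the class of \<open>r\<close> is the existence of a
            pair from r' to \<open>r\<close>; the cocycle is transported along it, so the class C
            has a representative over \<open>r\<close> itself.\<close>
          define \<sigma> where "\<sigma> = twist l \<alpha> \<tau>"
          have \<sigma>: "\<sigma> \<in> carrier (Z2_c r)" unfolding \<sigma>_def by (rule twist_Z2_c[OF l \<tau>(1)])
          have iso: "hopf_isomorphic (H_alg \<tau> r') (H_alg \<sigma> r)"
            by (rule hopf_isomorphic_of_cls[OF r \<tau>(1) \<sigma> l]) (simp add: \<sigma>_def)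
          then have "\<not> symmetric \<sigma>"
            using \<tau>(2) cocommutative_hopf_isomorphic[OF hopf_isomorphic_sym[OF iso]]
            by (auto simp: cocommutative_H_iff symmetric_def)
          then have S: "\<sigma> \<in> S" using \<sigma> by (simp add: S_def)
          have "(X, \<E> \<sigma>) \<in> R"
            using iso X \<E>[OF S] class_hopf_iso_H_ext_iff[OF act \<tau>(1) r \<sigma>]
            by (auto simp: XE \<E>_def R_def)
          then have "C = R `` {\<E> \<sigma>}" unfolding C by (rule equiv_class_eq[OF R])
          then show "C \<in> (\<lambda>\<tau>. R `` {\<E> \<tau>}) ` S" using S by blast
        qed
      qed
      fix \<tau> \<sigma> assume \<tau>: "\<tau> \<in> S" and \<sigma>: "\<sigma> \<in> S"
      then have Z: "\<tau> \<in> carrier (Z2_c r)" "\<sigma> \<in> carrier (Z2_c r)" and ns: "\<not> symmetric \<sigma>"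
        by (auto simp: S_def)
      have "R `` {\<E> \<tau>} = R `` {\<E> \<sigma>} \<longleftrightarrow> (\<E> \<tau>, \<E> \<sigma>) \<in> R"
        using eq_equiv_class_iff[OF R \<E>[OF \<tau>] \<E>[OF \<sigma>]] .
      \<comment> \<open>From here the fibres are compared: the isomorphism criterion with both
        actions equal to \<open>r\<close> is word for word the criterion for equal orbits.\<close>
      also have "\<dots> \<longleftrightarrow> hopf_isomorphic (H_alg \<tau> r) (H_alg \<sigma> r)"
        using \<E>[OF \<tau>] \<E>[OF \<sigma>] class_hopf_iso_H_ext_iff[OF r Z(1) r Z(2)] by (simp add: R_def \<E>_def)
      also have "\<dots> \<longleftrightarrow> twist_orbit r \<tau> = twist_orbit r \<sigma>"
        unfolding hopf_isomorphic_iff[OF p r r Z ns] twist_orbit_eq_iff ..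
      finally show "twist_orbit r \<tau> = twist_orbit r \<sigma> \<longleftrightarrow> R `` {\<E> \<tau>} = R `` {\<E> \<sigma>}" by blast
    qed
  }
qed

end
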